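(* Let $c\in\mathbb{R}$ with $c^2\neq 1$, let $\gamma=1/(c^2-1)$, and let $f$ be a periodic traveling wave of the sine-Gordon equation with speed $c$ and energy $E$. Then: (i) if $f$ is subluminal and rotational, $f$ is (temporally spectrally) stable; (ii) if $f$ is superluminal and rotational, $f$ is unstable; (iii) if $f$ is librational (subluminal or superluminal), $f$ is unstable.
   Context: Sine-Gordon equation: $u_{tt}-u_{xx}+\sin u=0$. A traveling wave of speed $c$ ($c^2\neq1$) is $u(x,t)=f(x-ct)$ where $f:\mathbb{R}\to\mathbb{R}$ solves $(c^2-1)f''+\sin f=0$; it satisfies $\tfrac12(c^2-1)(f')^2+1-\cos f=E$ for a constant $E$ (the energy). The wave is subluminal if $c^2<1$ and superluminal if $c^2>1$. It is librational if $0<E<2$, and rotational if $E<0$ (subluminal case) or $E>2$ (superluminal case); these are the periodic traveling waves, and $T>0$ denotes the smallest positive number with $f(z+T)=f(z)\pmod{2\pi}$ for all $z$. Set $\gamma=1/(c^2-1)$. The spectral problem (P) is $p''-2c\gamma\lambda p'+\gamma(\lambda^2+\cos f(z))p=0$, $\lambda\in\mathbb{C}$; its spectrum $\sigma(\mathrm{P})$ is the set of $\lambda\in\mathbb{C}$ for which (P) has a nontrivial solution bounded on $\mathbb{R}$. The wave $f$ is (temporally spectrally) stable if $\sigma(\mathrm{P})$ contains no $\lambda$ with $\operatorname{Re}\lambda>0$, and unstable otherwise. *)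

theory Defs
  imports "HOL-Analysis.Analysis"
begin

definition sg_traveling_wave :: "real \<Rightarrow> (real \<Rightarrow> real) \<Rightarrow> bool" where
  "sg_traveling_wave c f \<longleftrightarrow> c\<^sup>2 \<noteq> 1 \<and>
     (\<forall>z. (f has_real_derivative deriv f z) (at z)) \<and>
     (\<forall>z. (deriv f has_real_derivative deriv (deriv f) z) (at z)) \<and>
     (\<forall>z. (c\<^sup>2 - 1) * deriv (deriv f) z + sin (f z) = 0)"

text \<open>Energy density; it is constant along a traveling wave.\<close>
definition sg_energy :: "real \<Rightarrow> (real \<Rightarrow> real) \<Rightarrow> real \<Rightarrow> real" where
  "sg_energy c f z = (1/2) * (c\<^sup>2 - 1) * (deriv f z)\<^sup>2 + 1 - cos (f z)"

definition sg_gamma :: "real \<Rightarrow> real" where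
  "sg_gamma c = 1 / (c\<^sup>2 - 1)"

definition sg_spectrum :: "real \<Rightarrow> (real \<Rightarrow> real) \<Rightarrow> complex set" where
  "sg_spectrum c f = {l. \<exists>(p::real \<Rightarrow> complex) (p'::real \<Rightarrow> complex) (p''::real \<Rightarrow> complex).
     (\<forall>z. (p has_vector_derivative p' z) (at z)) \<and>
     (\<forall>z. (p' has_vector_derivative p'' z) (at z)) \<and>
     (\<forall>z. p'' z - 2 * of_real c * of_real (sg_gamma c) * l * p' z
            + of_real (sg_gamma c) * (l\<^sup>2 + of_real (cos (f z))) * p z = 0) \<and>
     bounded (range p) \<and> (\<exists>z. p z \<noteq> 0)}"

definition sg_stable :: "real \<Rightarrow> (real \<Rightarrow> real) \<Rightarrow> bool" where
  "sg_stable c f \<longleftrightarrow> (\<forall>l\<in>sg_spectrum c f. Re l \<le> 0)"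

definition sg_unstable :: "real \<Rightarrow> (real \<Rightarrow> real) \<Rightarrow> bool" where
  "sg_unstable c f \<longleftrightarrow> \<not> sg_stable c f"

end

theory Submission
  imports Defs "HOL-Real_Asymp.Real_Asymp"
begin

text \<open>
  Let \<open>g = 1 / (c\<^sup>2 - 1)\<close>, \<open>e = E - 1\<close> and \<open>u = cos f\<close>, so that \<open>u'\<^sup>2 = 2 g (1 - u\<^sup>2) (e + u)\<close>.

  Stability. For a rotational wave \<open>f'\<close> has no zeros, and \<open>a = f'' / f'\<close> is bounded. If \<open>p\<close> is a bounded
  solution for \<open>Re l > 0\<close> and \<open>D = p' - a p\<close>, then \<open>B = Re (D (cnj p) / l) - c g |p|\<^sup>2\<close> is bounded and
  \<open>B' = Re l (|D|\<^sup>2 / |l|\<^sup>2 - g |p|\<^sup>2)\<close>. For \<open>g < 0\<close> this dominates a multiple of \<open>|B|\<close>, so \<open>B = 0\<close> and \<open>p = 0\<close>.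

  Instability. The problem reduces to a one-gap Lame equation, whose solutions are explicit: with
  \<open>b = e + 2 g l\<^sup>2\<close> and \<open>s\<^sup>2 = b\<^sup>2 - 1\<close>,
  \<open>p = exp (\<integral> (u' / (2 (u + b)) + g l (c + s / (u + b))))\<close> solves the spectral problem. It is bounded once
  \<open>Re (l (c T + s \<integral>\<^sub>0\<^sup>T 1 / (u + b))) = 0\<close>, where \<open>T\<close> is a period of \<open>u\<close>. Such an \<open>l\<close> with \<open>Re l > 0\<close> is found
  by the intermediate value theorem.
\<close>

section \<open>Bounded functions, ODE uniqueness, periodicity and antiderivatives\<close>

text \<open>\<open>B\<close> is nondecreasing. If \<open>B z > 0\<close>, its slope to the right of
  \<open>z\<close> stays at least \<open>k * B z\<close>, so \<open>B\<close> is unbounded above; if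
  \<open>B z < 0\<close>, it is unbounded below to the left of \<open>z\<close>.\<close>

lemma bounded_if_deriv_dominates_zero:
  fixes B B' :: "real \<Rightarrow> real"
  assumes d: "\<And>z. (B has_real_derivative B' z) (at z)"
    and ge: "\<And>z. B' z \<ge> k * \<bar>B z\<bar>" and k: "k > 0"
    and bd: "\<And>z. \<bar>B z\<bar> \<le> M"
  shows "B z = 0"
proof (rule ccontr)
  assume nz: "B z \<noteq> 0"
  have "B' x \<ge> 0" for x
    using ge[of x] k mult_nonneg_nonneg[of k "\<bar>B x\<bar>"] by linarith
  then have mono: "B x \<le> B y" if "x \<le> y" for x y
    using that d by (intro DERIV_nonneg_imp_nondecreasing[of x y B]) auto
  \<comment> \<open>A step so long that \<open>B\<close> changes by at least
    \<open>2 * (M + 1)\<close> over it, more than two values in \<open>[-M, M]\<close> can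
    differ.\<close>
  define h where "h = 2 * (M + 1) / (k * \<bar>B z\<bar>)"
  have M: "M \<ge> 0" using bd[of z] by linarith
  have pos: "k * \<bar>B z\<bar> > 0" using k nz by simp
  have h: "h > 0" unfolding h_def using M pos by simp
  have hk: "h * (k * \<bar>B z\<bar>) = 2 * (M + 1)" unfolding h_def using k nz by simp
  consider "B z > 0" | "B z < 0" using nz by linarith
  then show False
  proof cases
    case 1
    obtain y where y: "z < y" "y < z + h" "B (z + h) - B z = (z + h - z) * B' y"
      using MVT2[of z "z + h" B B'] h d by auto
    have "k * \<bar>B z\<bar> \<le> k * \<bar>B y\<bar>" using mono[of z y] y(1) 1 k by simp
    then have "h * (k * \<bar>B z\<bar>) \<le> h * B' y" using ge[of y] h by simp
    with y hk bd[of z] bd[of "z + h"] show False by simp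
  next
    case 2
    obtain y where y: "z - h < y" "y < z" "B z - B (z - h) = (z - (z - h)) * B' y"
      using MVT2[of "z - h" z B B'] h d by auto
    have "k * \<bar>B z\<bar> \<le> k * \<bar>B y\<bar>" using mono[of y z] y(2) 2 k by simp
    then have "h * (k * \<bar>B z\<bar>) \<le> h * B' y" using ge[of y] h by simp
    with y hk bd[of z] bd[of "z - h"] show False by simp
  qed
qed

text \<open>Over a unit interval \<open>p' - a * p\<close> varies by at most \<open>H\<close>, hence
  \<open>p'\<close> by at most \<open>H + 2 * norm a * M\<close>; comparing \<open>p' z\<close> with
  the increment of \<open>p\<close>, of size at most \<open>2 * M\<close>, gives the bound. The
  spectrum only asks that \<open>p\<close> be bounded, but the stability argument needs
  \<open>p'\<close> bounded as well.\<close>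

lemma bounded_imp_bounded_deriv:
  fixes p p' h :: "real \<Rightarrow> complex"
  assumes p: "\<And>z. (p has_vector_derivative p' z) (at z)"
    and p': "\<And>z. (p' has_vector_derivative (a * p' z + h z)) (at z)"
    and bp: "\<And>z. norm (p z) \<le> M" and bh: "\<And>z. norm (h z) \<le> H"
  shows "norm (p' z) \<le> 2 * M + (H + 2 * norm a * M)"
proof -
  define G where "G = (\<lambda>x. p' x - a * p x)"
  have G: "(G has_vector_derivative h x) (at x)" for x
    unfolding G_def by (auto intro!: derivative_eq_intros p p')
  have M: "M \<ge> 0" using bp[of z] norm_ge_zero order_trans by blast
  have H: "H \<ge> 0" using bh[of z] norm_ge_zero order_trans by blast
  have onorm: "onorm (\<lambda>t::real. t *\<^sub>R v) \<le> K" if "norm v \<le> K" for v :: complex and K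
    using that by (intro onorm_le) (auto simp: mult.commute[of K] intro: mult_left_mono)
  have GB: "norm (G x - G z) \<le> H" if "x \<in> {z..z+1}" for x
  proof -
    have "norm (G x - G z) \<le> H * norm (x - z)"
      using that G bh
      by (intro differentiable_bound[of "{z..z+1}" G "\<lambda>x t. t *\<^sub>R h x"])
        (auto simp: has_vector_derivative_def intro: has_derivative_at_withinI onorm)
    also have "\<dots> \<le> H * 1" using that H by (intro mult_left_mono) auto
    finally show ?thesis by simp
  qed
  have PB: "norm (p' x - p' z) \<le> H + 2 * norm a * M" if "x \<in> {z..z+1}" for x
  proof -
    have "p' x - p' z = (G x - G z) + a * (p x - p z)" unfolding G_def by (simp add: algebra_simps)
    then have "norm (p' x - p' z) \<le> norm (G x - G z) + norm (a * (p x - p z))"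
      using norm_triangle_ineq by metis
    also have "norm (a * (p x - p z)) \<le> norm a * (M + M)"
      unfolding norm_mult using bp[of x] bp[of z] norm_triangle_ineq4[of "p x" "p z"]
      by (intro mult_left_mono) auto
    finally show ?thesis using GB[OF that] by (simp add: algebra_simps)
  qed
  have "norm ((p (z+1) - (z+1 - z) *\<^sub>R p' z) - (p z - (z - z) *\<^sub>R p' z)) \<le> (H + 2 * norm a * M) * norm (z + 1 - z)"
    using onorm[OF PB]
    by (intro differentiable_bound[of "{z..z+1}" "\<lambda>x. p x - (x - z) *\<^sub>R p' z" "\<lambda>x t. t *\<^sub>R (p' x - p' z)"])
      (auto intro!: derivative_eq_intros has_derivative_at_withinI[OF p[unfolded has_vector_derivative_def]]
        simp: scaleR_diff_right)
  then have "norm (p (z+1) - p z - p' z) \<le> H + 2 * norm a * M" by (simp add: algebra_simps)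
  moreover have "norm (p' z) \<le> norm (p (z+1)) + norm (p z) + norm (p (z+1) - p z - p' z)"
    using norm_triangle_ineq4[of "p (z+1) - p z" "p (z+1) - p z - p' z"]
      norm_triangle_ineq4[of "p (z+1)" "p z"] by simp
  ultimately show ?thesis using bp[of z] bp[of "z+1"] by simp
qed

text \<open>Gronwall's argument for the squared distance \<open>S\<close> in the phase plane. The
  Lipschitz bound is required only along the two solutions, which suits a polynomial
  \<open>F\<close> and bounded orbits.\<close>

lemma second_order_ode_unique:
  fixes v v' w w' F :: "real \<Rightarrow> real"
  assumes v: "\<And>z. (v has_real_derivative v' z) (at z)" "\<And>z. (v' has_real_derivative F (v z)) (at z)"
    and w: "\<And>z. (w has_real_derivative w' z) (at z)" "\<And>z. (w' has_real_derivative F (w z)) (at z)"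
    and lip: "\<And>z. \<bar>F (v z) - F (w z)\<bar> \<le> L * \<bar>v z - w z\<bar>" and L: "L \<ge> 0"
    and init: "v z0 = w z0" "v' z0 = w' z0"
  shows "v z = w z"
proof -
  define d d' where "d = (\<lambda>z. v z - w z)" and "d' = (\<lambda>z. v' z - w' z)"
  define S S' where "S = (\<lambda>z. (d z)\<^sup>2 + (d' z)\<^sup>2)"
    and "S' = (\<lambda>z. 2 * d z * d' z + 2 * d' z * (F (v z) - F (w z)))"
  have S: "(S has_real_derivative S' z) (at z)" for z
    unfolding S_def S'_def d_def d'_def
    by (auto intro!: derivative_eq_intros v w simp: algebra_simps)
  have S0: "S z0 = 0" using init by (simp add: S_def d_def d'_def)
  have S'B: "\<bar>S' z\<bar> \<le> (1 + L) * S z" for z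
  proof -
    have "\<bar>S' z\<bar> \<le> 2 * (\<bar>d z\<bar> * \<bar>d' z\<bar>) + 2 * (\<bar>d' z\<bar> * \<bar>F (v z) - F (w z)\<bar>)"
      unfolding S'_def
      using abs_triangle_ineq[of "2 * d z * d' z" "2 * d' z * (F (v z) - F (w z))"]
      by (simp add: abs_mult)
    also have "\<dots> \<le> 2 * (\<bar>d z\<bar> * \<bar>d' z\<bar>) + 2 * (\<bar>d' z\<bar> * (L * \<bar>d z\<bar>))"
      using lip[of z] unfolding d_def by (auto intro!: mult_left_mono)
    also have "\<dots> = (1 + L) * (2 * \<bar>d z\<bar> * \<bar>d' z\<bar>)" by (simp add: algebra_simps)
    also have "\<dots> \<le> (1 + L) * S z"
      using L sum_squares_bound[of "\<bar>d z\<bar>" "\<bar>d' z\<bar>"] unfolding S_def by (intro mult_left_mono) auto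
    finally show ?thesis .
  qed
  \<comment> \<open>By \<open>S'B\<close>, \<open>S z * exp (- (1 + L) * z)\<close> is nonincreasing
    and \<open>S z * exp ((1 + L) * z)\<close> is nondecreasing; the first settles \<open>z\<close>
    to the right of \<open>z0\<close>, the second \<open>z\<close> to the left.\<close>
  have "S z \<le> 0"
  proof (cases "z0 \<le> z")
    case True
    have "S z * exp (- (1 + L) * z) \<le> S z0 * exp (- (1 + L) * z0)"
    proof (rule DERIV_nonpos_imp_nonincreasing[OF True], intro exI conjI)
      fix x
      show "((\<lambda>z. S z * exp (- (1 + L) * z)) has_real_derivative (S' x - (1 + L) * S x) * exp (- (1 + L) * x)) (at x)"
        by (auto intro!: derivative_eq_intros S simp: algebra_simps)
      show "(S' x - (1 + L) * S x) * exp (- (1 + L) * x) \<le> 0"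
        using S'B[of x] by (intro mult_nonpos_nonneg) auto
    qed
    then show ?thesis using S0 by (simp add: mult_le_0_iff)
  next
    case False
    have "S z * exp ((1 + L) * z) \<le> S z0 * exp ((1 + L) * z0)"
    proof (rule DERIV_nonneg_imp_nondecreasing[of z z0], goal_cases)
      case 1 then show ?case using False by simp
    next
      case (2 x)
      have "((\<lambda>z. S z * exp ((1 + L) * z)) has_real_derivative (S' x + (1 + L) * S x) * exp ((1 + L) * x)) (at x)"
        by (auto intro!: derivative_eq_intros S simp: algebra_simps)
      moreover have "(S' x + (1 + L) * S x) * exp ((1 + L) * x) \<ge> 0"
        using S'B[of x] by (intro mult_nonneg_nonneg) auto
      ultimately show ?case by blast
    qed
    then show ?thesis using S0 by (simp add: mult_le_0_iff)
  qed
  then show ?thesis unfolding S_def d_def by (simp add: sum_power2_le_zero_iff)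
qed

lemma periodic_continuous_bounded:
  fixes h :: "real \<Rightarrow> complex"
  assumes cont: "continuous_on UNIV h" and T: "T > 0" and per: "\<And>z. h (z + T) = h z"
  shows "bounded (range h)"
proof -
  have per_nat: "h (z + real n * T) = h z" for z n
  proof (induction n)
    case (Suc n)
    have "h (z + real (Suc n) * T) = h ((z + real n * T) + T)" by (simp add: algebra_simps)
    then show ?case using per Suc by simp
  qed simp
  have per_int: "h (z + real_of_int m * T) = h z" for z m
  proof (cases "m \<ge> 0")
    case True then show ?thesis using per_nat[of z "nat m"] by simp
  next
    case False then show ?thesis using per_nat[of "z + real_of_int m * T" "nat (- m)"] by simp
  qed
  have "range h \<subseteq> h ` {0..T}"
  proof
    fix y assume "y \<in> range h"
    then obtain z where y: "y = h z" by auto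
    define m where "m = \<lfloor>z / T\<rfloor>"
    have "real_of_int m \<le> z / T" "z / T < real_of_int m + 1" unfolding m_def by linarith+
    then have "real_of_int m * T \<le> z" "z < (real_of_int m + 1) * T"
      using T by (simp_all add: field_simps)
    then have "z + real_of_int (- m) * T \<in> {0..T}" by (simp add: algebra_simps)
    moreover have "h (z + real_of_int (- m) * T) = y" using per_int[of z "- m"] y by blast
    ultimately show "y \<in> h ` {0..T}" by force
  qed
  moreover have "bounded (h ` {0..T})"
    using cont by (intro compact_imp_bounded compact_continuous_image) (auto intro: continuous_on_subset)
  ultimately show ?thesis using bounded_subset by blast
qed

lemma continuous_imp_antiderivative:
  fixes h :: "real \<Rightarrow> complex"
  assumes "continuous_on UNIV h"
  shows "\<exists>H. H 0 = 0 \<and> (\<forall>z. (H has_vector_derivative h z) (at z))"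
proof (intro exI conjI allI)
  fix z :: real
  define m where "m = \<bar>z\<bar> + 1"
  have "((\<lambda>x. LBINT y=0..x. h y) has_vector_derivative h z) (at z within {-m..m})"
    using interval_integral_FTC2[of "-m" 0 m h z, OF _ _ continuous_on_subset[OF assms]]
    by (simp add: m_def zero_ereal_def)
  moreover have "at z within {-m..m} = at z"
    by (rule at_within_interior) (unfold interior_atLeastAtMost_real m_def, simp, linarith)
  ultimately show "((\<lambda>x. LBINT y=0..x. h y) has_vector_derivative h z) (at z)" by simp
qed (simp add: zero_ereal_def)

text \<open>The increment of \<open>H\<close> over a period has derivative zero, so it can be
  evaluated at 0.\<close>

lemma antiderivative_eq_integral:
  fixes h H :: "real \<Rightarrow> complex"
  assumes H: "\<And>z. (H has_vector_derivative h z) (at z)" and per: "\<And>z. h (z + T) = h z" and T: "T > 0"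
  shows "H (z + T) - H z = integral {0..T} h"
proof -
  have D: "((\<lambda>z. H (z + T) - H z) has_vector_derivative 0) (at x)" for x
  proof -
    have "((H \<circ> (\<lambda>z. z + T)) has_vector_derivative 1 *\<^sub>R h (x + T)) (at x)"
      by (rule vector_diff_chain_at) (auto intro!: derivative_eq_intros H)
    then have "((\<lambda>z. H (z + T) - H z) has_vector_derivative h (x + T) - h x) (at x)"
      by (auto intro!: derivative_eq_intros H simp: o_def)
    then show ?thesis using per by simp
  qed
  obtain k where k: "\<And>z. H (z + T) - H z = k"
    using has_vector_derivative_zero_constant[of UNIV "\<lambda>z. H (z + T) - H z"] D by auto
  have "(h has_integral (H T - H 0)) {0..T}"
    using T by (intro fundamental_theorem_of_calculus) (auto intro: H has_vector_derivative_at_within)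
  then show ?thesis using k[of z] k[of 0] integral_unique[of h "H T - H 0" "{0..T}"] by simp
qed

section \<open>Stability of subluminal rotational waves\<close>

text \<open>The monotonicity argument for \<open>B\<close>, with an abstract potential
  \<open>V\<close> and a bounded Riccati solution \<open>a\<close>; for the wave these are
  \<open>cos f\<close> and \<open>f'' / f'\<close>.\<close>

lemma no_unstable_bounded_solution:
  fixes c g :: real and p p' p'' :: "real \<Rightarrow> complex" and a V :: "real \<Rightarrow> real" and l :: complex
  assumes p: "\<And>z. (p has_vector_derivative p' z) (at z)"
    and p': "\<And>z. (p' has_vector_derivative p'' z) (at z)"
    and ode: "\<And>z. p'' z - 2 * of_real c * of_real g * l * p' z
            + of_real g * (l\<^sup>2 + of_real (V z)) * p z = 0"
    and bp: "\<And>z. norm (p z) \<le> M" and g: "g < 0" and l: "Re l > 0"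
    and a: "\<And>z. (a has_real_derivative (- g * V z - (a z)\<^sup>2)) (at z)"
    and ba: "\<And>z. \<bar>a z\<bar> \<le> A" and bV: "\<And>z. \<bar>V z\<bar> \<le> W"
  shows "p z = 0"
proof -
  \<comment> \<open>\<open>a\<close> solves the Riccati equation, so the Hill operator factors as \<open>(d/dz + a) (d/dz - a)\<close>.\<close>
  define D where "D = (\<lambda>z. p' z - of_real (a z) * p z)"
  have ac: "((\<lambda>z. complex_of_real (a z)) has_vector_derivative of_real (- g * V z - (a z)\<^sup>2)) (at z)" for z
    using bounded_linear.has_vector_derivative[OF bounded_linear_of_real a[unfolded has_real_derivative_iff_has_vector_derivative]] .
  have pc: "((\<lambda>z. cnj (p z)) has_vector_derivative cnj (p' z)) (at z)" for z
    using bounded_linear.has_vector_derivative[OF bounded_linear_cnj p] .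
  have D: "(D has_vector_derivative (2 * of_real c * of_real g * l * p' z - of_real g * l\<^sup>2 * p z - of_real (a z) * D z)) (at z)" for z
  proof -
    have "(D has_vector_derivative p'' z - (of_real (a z) * p' z + of_real (- g * V z - (a z)\<^sup>2) * p z)) (at z)"
      unfolding D_def
      by (intro has_vector_derivative_diff has_vector_derivative_mult p' ac p)
    moreover have "p'' z - (of_real (a z) * p' z + of_real (- g * V z - (a z)\<^sup>2) * p z)
       = 2 * of_real c * of_real g * l * p' z - of_real g * l\<^sup>2 * p z - of_real (a z) * D z"
      using ode[of z] unfolding D_def by (simp add: algebra_simps power2_eq_square)
    ultimately show ?thesis by simp
  qed
  have l0: "l \<noteq> 0" using l by auto
  define B where "B = (\<lambda>z. Re (D z * cnj (p z) / l - of_real (c * g) * (p z * cnj (p z))))"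
  define B' where "B' = (\<lambda>z. Re l * ((norm (D z) / norm l)\<^sup>2 - g * (norm (p z))\<^sup>2))"
  have B: "(B has_real_derivative B' z) (at z)" for z
  proof -
    let ?D' = "2 * of_real c * of_real g * l * p' z - of_real g * l\<^sup>2 * p z - of_real (a z) * D z"
    have *: "((\<lambda>z. (D z * cnj (p z)) * inverse l - of_real (c * g) * (p z * cnj (p z))) has_vector_derivative
       (D z * cnj (p' z) + ?D' * cnj (p z)) * inverse l - of_real (c * g) * (p z * cnj (p' z) + p' z * cnj (p z))) (at z)"
      by (intro has_vector_derivative_diff has_vector_derivative_mult has_vector_derivative_mult_left
         has_vector_derivative_mult_right p pc D)
    \<comment> \<open>The last bracket is a number minus its conjugate, so it disappears under
      \<open>Re\<close>. Producing this cancellation is the purpose of the term \<open>c * g\<close>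
      times \<open>|p|^2\<close> in \<open>B\<close>.\<close>
    have "(D z * cnj (p' z) + ?D' * cnj (p z)) * inverse l - of_real (c * g) * (p z * cnj (p' z) + p' z * cnj (p z))
      = (D z * cnj (D z)) * inverse l - of_real g * l * (p z * cnj (p z))
         + of_real (c * g) * (p' z * cnj (p z) - cnj (p' z * cnj (p z)))"
      unfolding D_def using l0 by (simp add: field_simps power2_eq_square)
    also have "Re \<dots> = B' z"
      unfolding B'_def complex_norm_square[symmetric]
      by (simp add: complex_mult_cnj Re_divide cmod_power2 power_divide field_simps inverse_eq_divide)
    finally show ?thesis
      using bounded_linear.has_vector_derivative[OF bounded_linear_Re *]
      unfolding B_def has_real_derivative_iff_has_vector_derivative divide_inverse by simp
  qed
  \<comment> \<open>The sum of the coefficients of \<open>d^2\<close> and of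
    \<open>- g * n^2\<close> in the estimate of \<open>|B|\<close> below, hence at least as large as
    each of them.\<close>
  define m where "m = 1/2 + (1/2 + \<bar>c * g\<bar>) / (-g)"
  have m: "m > 0" unfolding m_def using g by (intro add_pos_nonneg divide_nonneg_pos) auto
  have absB: "\<bar>B z\<bar> \<le> norm (D z) / norm l * norm (p z) + \<bar>c * g\<bar> * (norm (p z))\<^sup>2" for z
  proof -
    have "\<bar>B z\<bar> \<le> norm (D z * cnj (p z) / l - of_real (c * g) * (p z * cnj (p z)))"
      unfolding B_def by (rule abs_Re_le_cmod)
    also have "\<dots> \<le> norm (D z * cnj (p z) / l) + norm (of_real (c * g) * (p z * cnj (p z)))"
      by (rule norm_triangle_ineq4)
    finally show ?thesis by (simp add: norm_mult norm_divide power2_eq_square abs_mult)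
  qed
  have "B z = 0" for z
  proof (rule bounded_if_deriv_dominates_zero[OF B])
    show "Re l / m > 0" using l m by simp
    fix z
    define d n where "d = norm (D z) / norm l" and "n = norm (p z)"
    have "\<bar>B z\<bar> \<le> d * n + \<bar>c * g\<bar> * n\<^sup>2" using absB[of z] by (simp add: d_def n_def)
    also have "d * n \<le> d\<^sup>2 / 2 + n\<^sup>2 / 2" using sum_squares_bound[of d n] by simp
    also have "d\<^sup>2 / 2 + n\<^sup>2 / 2 + \<bar>c * g\<bar> * n\<^sup>2 = 1/2 * d\<^sup>2 + ((1/2 + \<bar>c * g\<bar>) / (-g)) * (- g * n\<^sup>2)"
      using g by (simp add: field_simps)
    also have "\<dots> \<le> m * d\<^sup>2 + m * (- g * n\<^sup>2)"
      using g unfolding m_def by (intro add_mono mult_right_mono) (auto simp: divide_nonpos_neg divide_nonneg_neg mult_nonpos_nonneg)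
    finally have "\<bar>B z\<bar> \<le> m * (d\<^sup>2 - g * n\<^sup>2)" by (simp add: algebra_simps)
    then have "Re l / m * \<bar>B z\<bar> \<le> Re l / m * (m * (d\<^sup>2 - g * n\<^sup>2))"
      using l m by (intro mult_left_mono) auto
    then show "Re l / m * \<bar>B z\<bar> \<le> B' z" using m by (simp add: B'_def d_def n_def)
  next
    fix z
    have M: "M \<ge> 0" using bp[of z] norm_ge_zero order_trans by blast
    define H where "H = \<bar>g\<bar> * ((norm l)\<^sup>2 + W) * M"
    have bh: "norm (- (of_real g * (l\<^sup>2 + of_real (V z)) * p z)) \<le> H" for z
    proof -
      have "norm (l\<^sup>2 + of_real (V z)) \<le> (norm l)\<^sup>2 + W"
        using norm_triangle_ineq[of "l\<^sup>2" "of_real (V z)"] bV[of z] by (simp add: norm_power)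
      moreover have "W \<ge> 0" using bV[of z] by linarith
      ultimately show ?thesis unfolding H_def using bp M by (auto simp: norm_mult intro!: mult_mono)
    qed
    have p2: "(p' has_vector_derivative (2 * of_real c * of_real g * l) * p' z
        + - (of_real g * (l\<^sup>2 + of_real (V z)) * p z)) (at z)" for z
    proof -
      have "p'' z = (2 * of_real c * of_real g * l) * p' z
        + - (of_real g * (l\<^sup>2 + of_real (V z)) * p z)"
        using ode[of z] by algebra
      then show ?thesis using p'[of z] by simp
    qed
    define K where "K = 2 * M + (H + 2 * norm (2 * of_real c * of_real g * l) * M)"
    have K: "norm (p' z) \<le> K"
      unfolding K_def by (rule bounded_imp_bounded_deriv[OF p p2 bp bh])
    have "norm (D z) \<le> K + A * M"
    proof -
      have "norm (D z) \<le> norm (p' z) + norm (of_real (a z) * p z)"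
        unfolding D_def by (rule norm_triangle_ineq4)
      also have "norm (of_real (a z) * p z) \<le> A * M"
        unfolding norm_mult using ba[of z] bp[of z] by (auto intro!: mult_mono)
      finally show ?thesis using K by simp
    qed
    then have "norm (D z) / norm l * norm (p z) + \<bar>c * g\<bar> * (norm (p z))\<^sup>2
       \<le> (K + A * M) / norm l * M + \<bar>c * g\<bar> * M\<^sup>2"
      using bp[of z] M l0 by (intro add_mono mult_mono divide_right_mono mult_left_mono power_mono)
        (auto intro: order_trans[OF norm_ge_zero] divide_nonneg_nonneg)
    then show "\<bar>B z\<bar> \<le> (K + A * M) / norm l * M + \<bar>c * g\<bar> * M\<^sup>2" using absB[of z] by simp
  qed
  \<comment> \<open>With \<open>B\<close> constant, \<open>B'\<close> vanishes; for
    \<open>g < 0\<close> it is a sum of two nonnegative terms, one of which is a positive multiple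
    of \<open>|p|^2\<close>.\<close>
  then have "B = (\<lambda>_. 0)" by auto
  then have "B' z = 0" using B[of z] DERIV_unique[OF DERIV_const] by metis
  then have "(norm (D z) / norm l)\<^sup>2 + (- g) * (norm (p z))\<^sup>2 = 0" using l unfolding B'_def by simp
  moreover have "(- g) * (norm (p z))\<^sup>2 \<ge> 0" using g by (intro mult_nonneg_nonneg) auto
  ultimately have "(- g) * (norm (p z))\<^sup>2 = 0"
    using zero_le_power2[of "norm (D z) / norm l"] by linarith
  then show ?thesis using g by simp
qed

text \<open>Since \<open>g\<close> and \<open>E\<close> are negative, the energy identity gives
  \<open>f'^2 >= 2 * g * E > 0\<close>. As \<open>f'\<close> solves the spectral equation at
  \<open>l = 0\<close>, its logarithmic derivative \<open>- g * sin f / f'\<close> is a bounded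
  solution of the Riccati equation.\<close>

lemma subluminal_rotational_stable:
  assumes tw: "sg_traveling_wave c f" and en: "\<forall>z. sg_energy c f z = E"
    and c: "c\<^sup>2 < 1" and E: "E < 0"
  shows "sg_stable c f"
  unfolding sg_stable_def
proof
  fix l assume "l \<in> sg_spectrum c f"
  then obtain p p' p'' where p: "\<And>z. (p has_vector_derivative p' z) (at z)"
    and p': "\<And>z. (p' has_vector_derivative p'' z) (at z)"
    and ode: "\<And>z. p'' z - 2 * of_real c * of_real (sg_gamma c) * l * p' z
            + of_real (sg_gamma c) * (l\<^sup>2 + of_real (cos (f z))) * p z = 0"
    and b: "bounded (range p)" and nz: "\<exists>z. p z \<noteq> 0"
    unfolding sg_spectrum_def by blast
  obtain M where M: "\<And>z. norm (p z) \<le> M" using b unfolding bounded_iff by auto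
  define g where "g = sg_gamma c"
  have g: "g < 0" using c by (simp add: g_def sg_gamma_def)
  have gc: "g * (c\<^sup>2 - 1) = 1" using c by (simp add: g_def sg_gamma_def)
  note tw = tw[unfolded sg_traveling_wave_def]
  have f: "(f has_real_derivative deriv f z) (at z)" 
    and f': "(deriv f has_real_derivative deriv (deriv f) z) (at z)" 
    and eq: "(c\<^sup>2 - 1) * deriv (deriv f) z + sin (f z) = 0" for z using tw by auto
  have f'': "deriv (deriv f) z = - g * sin (f z)" for z
  proof -
    have "g * ((c\<^sup>2 - 1) * deriv (deriv f) z + sin (f z)) = 0" using eq by simp
    then show ?thesis using gc by algebra
  qed
  have sq: "(deriv f z)\<^sup>2 \<ge> 2 * g * E" for z
  proof -
    have "(c\<^sup>2 - 1) * (deriv f z)\<^sup>2 = 2 * (E - 1 + cos (f z))" 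
      using en[rule_format, of z] unfolding sg_energy_def by simp
    then have "(deriv f z)\<^sup>2 = 2 * g * (E - 1 + cos (f z))" using gc by algebra
    moreover have "g * (E - 1 + cos (f z)) \<ge> g * E" using g by (intro mult_left_mono_neg) auto
    ultimately show ?thesis by linarith
  qed
  have gE: "g * E > 0" using g E by (simp add: mult_neg_neg)
  have nz': "deriv f z \<noteq> 0" for z using sq[of z] gE by (auto simp: mult.commute)
  have der: "((\<lambda>z. - g * sin (f z) / deriv f z) has_real_derivative
      (- g * cos (f z) - (- g * sin (f z) / deriv f z)\<^sup>2)) (at z)" for z
    using nz'[of z] by (auto intro!: derivative_eq_intros f f' simp: f'' field_simps power2_eq_square)
  have bd: "\<bar>- g * sin (f z) / deriv f z\<bar> \<le> \<bar>g\<bar> / sqrt (2 * g * E)" for z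
  proof -
    have "sqrt (2 * g * E) \<le> \<bar>deriv f z\<bar>" using sq[of z] real_sqrt_le_mono by fastforce
    then show ?thesis using gE by (auto simp: abs_mult mult.commute[of E] intro!: frac_le mult_left_le)
  qed
  show "Re l \<le> 0"
  proof (rule ccontr)
    assume "\<not> Re l \<le> 0"
    then have "p z = 0" for z
      using no_unstable_bounded_solution[OF p p' ode[folded g_def] M g _ der bd abs_cos_le_one] by simp
    with nz show False by auto
  qed
qed

section \<open>Periodicity of orbits with a cubic first integral\<close>

text \<open>Models \<open>u = cos f\<close> with \<open>e = E - 1\<close>. The second-order equation
  is assumed separately because differentiating the first integral yields it only where
  \<open>u'\<close> is nonzero. The condition on \<open>e\<close> makes the roots \<open>1\<close>,
  \<open>-1\<close>, \<open>-e\<close> of the cubic distinct; it excludes the energies 2 and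
  0.\<close>

locale elliptic_orbit =
  fixes u u' :: "real \<Rightarrow> real" and g e :: real
  assumes du: "(u has_real_derivative u' z) (at z)"
    and du': "(u' has_real_derivative g * (1 - 2 * e * u z - 3 * (u z)\<^sup>2)) (at z)"
    and first_integral: "(u' z)\<^sup>2 = 2 * g * (1 - (u z)\<^sup>2) * (e + u z)"
    and u_bound: "\<bar>u z\<bar> \<le> 1"
    and g_nz: "g \<noteq> 0" and simple_roots: "e \<noteq> 1" "e \<noteq> -1"
begin

lemma continuous_u: "isCont u z" and continuous_u': "isCont u' z"
  using du du' DERIV_isCont by blast+

text \<open>Otherwise \<open>u\<close> would converge monotonically to a double root of the cubic, which has only simple roots.\<close>
lemma critical_point_beyond: "\<exists>z>Z. u' z = 0"
proof (rule ccontr)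
  assume no: "\<not> (\<exists>z>Z. u' z = 0)"
  have sgn: "(\<forall>z>Z. u' z > 0) \<or> (\<forall>z>Z. u' z < 0)"
  proof (rule ccontr)
    assume "\<not> ((\<forall>z>Z. u' z > 0) \<or> (\<forall>z>Z. u' z < 0))"
    then obtain x y where "x > Z" "u' x < 0" "y > Z" "u' y > 0" using no by force
    have cont: "continuous_on S u'" for S using continuous_u' by (simp add: continuous_at_imp_continuous_on)
    have "\<exists>t\<ge>min x y. u' t = 0"
    proof (cases "x \<le> y")
      case True
      then show ?thesis using IVT'[of u' x 0 y] cont \<open>u' x < 0\<close> \<open>u' y > 0\<close> by auto
    next
      case False
      then show ?thesis using IVT2'[of u' x 0 y] cont \<open>u' x < 0\<close> \<open>u' y > 0\<close> by auto
    qed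
    then obtain t where "t \<ge> min x y" "u' t = 0" by blast
    moreover have "min x y > Z" using \<open>x > Z\<close> \<open>y > Z\<close> by simp
    ultimately have "t > Z" by linarith
    then show False using no \<open>u' t = 0\<close> by blast
  qed
  have mono_u: "u x \<le> u y" if A: "\<forall>z>Z. u' z > 0" and "Z < x" "x \<le> y" for x y
  proof (rule DERIV_nonneg_imp_nondecreasing[OF \<open>x \<le> y\<close>])
    fix t assume "x \<le> t"
    then have "u' t > 0" using A \<open>Z < x\<close> by auto
    then show "\<exists>d. (u has_real_derivative d) (at t) \<and> 0 \<le> d" using du less_imp_le by blast
  qed
  have antimono_u: "u y \<le> u x" if A: "\<forall>z>Z. u' z < 0" and "Z < x" "x \<le> y" for x y
  proof (rule DERIV_nonpos_imp_nonincreasing[OF \<open>x \<le> y\<close>])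
    fix t assume "x \<le> t"
    then have "u' t < 0" using A \<open>Z < x\<close> by auto
    then show "\<exists>d. (u has_real_derivative d) (at t) \<and> d \<le> 0" using du less_imp_le by blast
  qed
  define v where "v = (\<lambda>n. u (Z + 1 + real n))"
  have "monoseq v"
  proof -
    have "incseq v \<or> decseq v"
      using sgn
    proof
      assume A: "\<forall>z>Z. u' z > 0"
      show ?thesis unfolding v_def by (rule disjI1, intro incseq_SucI mono_u[OF A]) auto
    next
      assume A: "\<forall>z>Z. u' z < 0"
      show ?thesis unfolding v_def by (rule disjI2, intro decseq_SucI antimono_u[OF A]) auto
    qed
    then show ?thesis by (auto simp: monoseq_iff)
  qed
  moreover have "Bseq v" using u_bound by (intro BseqI'[of _ 1]) (simp add: v_def)
  ultimately obtain L where L: "v \<longlonglongrightarrow> L" using Bseq_monoseq_convergent convergent_def by blast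
  define w where "w = (\<lambda>n. u' (Z + 1 + real n))"
  have "\<exists>x>Z + 1 + real n. x < Z + 1 + real (Suc n) \<and> v (Suc n) - v n = u' x" for n
    using MVT2[of "Z + 1 + real n" "Z + 1 + real (Suc n)" u u'] du by (auto simp: v_def)
  then obtain \<xi> where \<xi>: "\<And>n. \<xi> n > Z + 1 + real n" "\<And>n. \<xi> n < Z + 1 + real (Suc n)"
      "\<And>n. v (Suc n) - v n = u' (\<xi> n)" by metis
  \<comment> \<open>Half the derivative of the cubic \<open>?Q\<close> introduced below; along the
    orbit it equals the derivative of \<open>u'\<close>.\<close>
  let ?Q' = "\<lambda>x. g * (1 - 2 * e * x - 3 * x\<^sup>2)"
  have "\<exists>x>Z + 1 + real n. x < Z + 1 + real (Suc n) \<and> w (Suc n) - w n = ?Q' (u x)" for n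
    using MVT2[of "Z + 1 + real n" "Z + 1 + real (Suc n)" u' "\<lambda>z. ?Q' (u z)"] du' by (auto simp: w_def)
  then obtain \<eta> where \<eta>: "\<And>n. \<eta> n > Z + 1 + real n" "\<And>n. \<eta> n < Z + 1 + real (Suc n)"
      "\<And>n. w (Suc n) - w n = ?Q' (u (\<eta> n))" by metis
  \<comment> \<open>By monotonicity of \<open>u\<close>, values at points between consecutive sample
    points are squeezed to the same limit \<open>L\<close>. This applies to both families of mean
    value points.\<close>
  have between: "(\<lambda>n. u (\<zeta> n)) \<longlonglongrightarrow> L"
    if \<zeta>: "\<And>n. \<zeta> n > Z + 1 + real n" "\<And>n. \<zeta> n < Z + 1 + real (Suc n)" for \<zeta>
  proof -
    have LS: "(\<lambda>n. v (Suc n)) \<longlonglongrightarrow> L" using L LIMSEQ_Suc by blast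
    have pos: "Z < \<zeta> n" for n using \<zeta>(1)[of n] by linarith
    show ?thesis using sgn
    proof
      assume A: "\<forall>z>Z. u' z > 0"
      show ?thesis
        by (rule tendsto_sandwich[OF _ _ L LS]; intro always_eventually allI)
          (use pos \<zeta>[THEN less_imp_le] in \<open>auto simp: v_def intro!: mono_u[OF A]\<close>)
    next
      assume A: "\<forall>z>Z. u' z < 0"
      show ?thesis
        by (rule tendsto_sandwich[OF _ _ LS L]; intro always_eventually allI)
          (use pos \<zeta>[THEN less_imp_le] in \<open>auto simp: v_def intro!: antimono_u[OF A]\<close>)
    qed
  qed
  let ?Q = "\<lambda>x. 2 * g * (1 - x\<^sup>2) * (e + x)"
  \<comment> \<open>The increments of \<open>u\<close> tend to 0, so \<open>u'\<close> tends to 0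
    along the mean value points, and \<open>L\<close> is a root of the cubic.\<close>
  have "(\<lambda>n. v (Suc n) - v n) \<longlonglongrightarrow> L - L" by (intro tendsto_diff L LIMSEQ_Suc)
  then have "(\<lambda>n. (u' (\<xi> n))\<^sup>2) \<longlonglongrightarrow> 0\<^sup>2" unfolding \<xi>(3) by (intro tendsto_power) simp
  moreover have "(\<lambda>n. ?Q (u (\<xi> n))) \<longlonglongrightarrow> ?Q L" by (intro tendsto_intros between \<xi>)
  ultimately have Q: "?Q L = 0" unfolding first_integral using LIMSEQ_unique[of "\<lambda>n. ?Q (u (\<xi> n))" "0\<^sup>2" "?Q L"] by simp
  \<comment> \<open>Now \<open>u'\<close> tends to 0 at the sample points too, so the increments of
    \<open>u'\<close> tend to 0 and \<open>L\<close> is also a root of the derivative of the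
    cubic.\<close>
  have "(\<lambda>n. ?Q (v n)) \<longlonglongrightarrow> ?Q L" by (intro tendsto_intros L)
  then have "(\<lambda>n. sqrt ((w n)\<^sup>2)) \<longlonglongrightarrow> sqrt 0"
    unfolding Q w_def first_integral v_def by (rule tendsto_real_sqrt)
  then have w0: "w \<longlonglongrightarrow> 0" by (simp add: tendsto_rabs_zero_iff)
  have "(\<lambda>n. w (Suc n) - w n) \<longlonglongrightarrow> 0 - 0" by (intro tendsto_diff w0 LIMSEQ_Suc)
  then have "(\<lambda>n. ?Q' (u (\<eta> n))) \<longlonglongrightarrow> 0" unfolding \<eta>(3) by simp
  moreover have "(\<lambda>n. ?Q' (u (\<eta> n))) \<longlonglongrightarrow> ?Q' L" by (intro tendsto_intros between \<eta>)
  ultimately have Q': "?Q' L = 0" using LIMSEQ_unique[of "\<lambda>n. ?Q' (u (\<eta> n))" 0 "?Q' L"] by simp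
  have c: "1 - 2 * e * L - 3 * L\<^sup>2 = 0" using Q' g_nz by simp
  have "L\<^sup>2 = 1 \<or> L = - e" using Q g_nz by auto
  then have "e\<^sup>2 = 1"
  proof
    assume 1: "L\<^sup>2 = 1"
    then have "e * L = - 1" using c by (simp add: mult.commute)
    then have "e\<^sup>2 * L\<^sup>2 = 1" unfolding power_mult_distrib[symmetric] by simp
    then show ?thesis using 1 by simp
  next
    assume "L = - e"
    then show ?thesis using c by (simp add: power2_eq_square)
  qed
  then show False using simple_roots by (simp add: power2_eq_1_iff)
qed

text \<open>The reflected orbit solves the same autonomous second-order equation and, because
  \<open>u' z0 = 0\<close>, has the same data at \<open>z0\<close>. The Lipschitz constant comes
  from the quadratic right-hand side on \<open>[-1, 1]\<close>.\<close>

lemma reflection: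
  assumes "u' z0 = 0"
  shows "u (2 * z0 - z) = u z"
proof (rule second_order_ode_unique[of "\<lambda>z. u (2 * z0 - z)" "\<lambda>z. - u' (2 * z0 - z)"
      "\<lambda>x. g * (1 - 2 * e * x - 3 * x\<^sup>2)" u u' "\<bar>g\<bar> * (2 * \<bar>e\<bar> + 6)" z0])
  fix z
  show "((\<lambda>z. u (2 * z0 - z)) has_real_derivative - u' (2 * z0 - z)) (at z)"
    by (rule DERIV_cong[OF DERIV_chain2[OF du]]) (auto intro!: derivative_eq_intros)
  show "((\<lambda>z. - u' (2 * z0 - z)) has_real_derivative
      g * (1 - 2 * e * u (2 * z0 - z) - 3 * (u (2 * z0 - z))\<^sup>2)) (at z)"
    by (rule DERIV_cong[OF DERIV_minus[OF DERIV_chain2[OF du']]]) (auto intro!: derivative_eq_intros)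
  show "(u has_real_derivative u' z) (at z)" by (rule du)
  show "(u' has_real_derivative g * (1 - 2 * e * u z - 3 * (u z)\<^sup>2)) (at z)" by (rule du')
  let ?x = "u (2 * z0 - z)" and ?y = "u z"
  have "g * (1 - 2 * e * ?x - 3 * ?x\<^sup>2) - g * (1 - 2 * e * ?y - 3 * ?y\<^sup>2)
      = g * (- 2 * e - 3 * (?x + ?y)) * (?x - ?y)" by (simp add: algebra_simps power2_eq_square)
  moreover have "\<bar>- 2 * e - 3 * (?x + ?y)\<bar> \<le> 2 * \<bar>e\<bar> + 6"
    using u_bound[of z] u_bound[of "2 * z0 - z"] abs_ge_self[of e] abs_ge_minus_self[of e]
    by (auto simp: abs_le_iff)
  ultimately show "\<bar>g * (1 - 2 * e * ?x - 3 * ?x\<^sup>2) - g * (1 - 2 * e * ?y - 3 * ?y\<^sup>2)\<bar>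
      \<le> \<bar>g\<bar> * (2 * \<bar>e\<bar> + 6) * \<bar>?x - ?y\<bar>"
    by (auto simp: abs_mult intro!: mult_right_mono mult_left_mono)
qed (use assms in auto)

text \<open>Reflections in two distinct critical points \<open>a\<close> and \<open>b\<close>
  compose to the translation by \<open>2 * (b - a)\<close>. Any positive period suffices for what
  follows, not necessarily the smallest.\<close>

lemma periodic: "\<exists>T>0. \<forall>z. u (z + T) = u z"
proof -
  obtain a where a: "u' a = 0" using critical_point_beyond by blast
  obtain b where b: "b > a" "u' b = 0" using critical_point_beyond by blast
  have "u (z + 2 * (b - a)) = u z" for z
    using reflection[OF b(2), of "2 * a - z"] reflection[OF a, of z] by (simp add: algebra_simps)
  then show ?thesis using b by (intro exI[of _ "2 * (b - a)"]) auto
qed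

end

section \<open>Explicit Floquet solutions of the spectral problem\<close>

lemma exp_has_vector_derivative:
  fixes h :: "real \<Rightarrow> complex"
  assumes "(h has_vector_derivative h') (at z)"
  shows "((\<lambda>z. exp (h z)) has_vector_derivative h' * exp (h z)) (at z)"
  using field_vector_diff_chain_at[OF assms DERIV_exp] by (simp add: o_def)

text \<open>\<open>U\<close>, \<open>D\<close>, \<open>w\<close>, \<open>v\<close> stand for
  \<open>u\<close>, \<open>u'\<close>, \<open>u + b\<close> and \<open>1 / (u + b)\<close> at a
  point. The identity is the Riccati form of the spectral equation for the logarithmic derivative
  \<open>r = D * v / 2 + g * l * (c + s * v)\<close>, with the derivative of \<open>r\<close>
  written out.\<close>

lemma riccati_identity:
  fixes U D g e c l s b v w :: complex
  assumes D: "D\<^sup>2 = 2 * g * (1 - U\<^sup>2) * (e + U)" and gc: "g * (c\<^sup>2 - 1) = 1"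
    and b: "b = e + 2 * g * l\<^sup>2" and s: "s\<^sup>2 = b\<^sup>2 - 1" and w: "w = U + b" and vw: "v * w = 1"
  shows "(D * (- D * v\<^sup>2) + g * (1 - 2 * e * U - 3 * U\<^sup>2) * v) / 2 + g * l * (s * (- D * v\<^sup>2))
     + (D * v / 2 + g * l * (c + s * v))\<^sup>2 - 2 * c * (g * l) * (D * v / 2 + g * l * (c + s * v)) + g * (l\<^sup>2 + U) = 0"
    (is "?lhs = 0")
proof -
  \<comment> \<open>For a product \<open>w\<close> of two solutions of \<open>q'' + Q q = 0\<close>
    with Wronskian \<open>W\<close>, one has \<open>2 w w'' - w'^2 + W^2 + 4 Q w^2 = 0\<close>; here
    \<open>W = 2 g l s\<close> and \<open>Q = g u - g^2 l^2\<close>.\<close>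
  have "2 * g * (1 - 2 * e * U - 3 * U\<^sup>2) * w - D\<^sup>2 + 4 * g\<^sup>2 * l\<^sup>2 * s\<^sup>2 + 4 * w\<^sup>2 * (g * U - g\<^sup>2 * l\<^sup>2) = 0"
    unfolding D s w b by algebra
  then have "v\<^sup>2 * (2 * g * (1 - 2 * e * U - 3 * U\<^sup>2) * w - D\<^sup>2 + 4 * g\<^sup>2 * l\<^sup>2 * s\<^sup>2) + 4 * (v * w)\<^sup>2 * (g * U - g\<^sup>2 * l\<^sup>2) = 0"
    by algebra
  moreover have "v\<^sup>2 * (2 * g * (1 - 2 * e * U - 3 * U\<^sup>2) * w) = 2 * g * (1 - 2 * e * U - 3 * U\<^sup>2) * v * (v * w)"
    by algebra
  ultimately have 1: "2 * g * (1 - 2 * e * U - 3 * U\<^sup>2) * v - v\<^sup>2 * D\<^sup>2 + 4 * g\<^sup>2 * l\<^sup>2 * s\<^sup>2 * v\<^sup>2 + 4 * (g * U - g\<^sup>2 * l\<^sup>2) = 0"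
    unfolding vw power_one mult_1_right by algebra
  \<comment> \<open>Removing the first-order term completes a square; this turns the resulting
    constant \<open>g l^2 - (g l c)^2\<close> into \<open>- g^2 l^2\<close>.\<close>
  have 2: "(g * l * c)\<^sup>2 = g * l\<^sup>2 + g\<^sup>2 * l\<^sup>2" using gc by algebra
  define h where "h = D * v / 2"
  have h: "D * v = 2 * h" unfolding h_def by simp
  have 3: "D * (D * v\<^sup>2) = 4 * h\<^sup>2" "D * v\<^sup>2 = 2 * h * v"
    using h by algebra+
  have "2 * ?lhs = (D * (- D * v\<^sup>2) + g * (1 - 2 * e * U - 3 * U\<^sup>2) * v)
     + 2 * (g * l * (s * (- D * v\<^sup>2))
     + (h + g * l * (c + s * v))\<^sup>2 - 2 * c * (g * l) * (h + g * l * (c + s * v)) + g * (l\<^sup>2 + U))"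
    unfolding h_def by simp
  also have "\<dots> = 0" using 1 2 3 h by algebra
  finally show ?thesis unfolding mult_eq_0_iff by (rule disjE) simp_all
qed

context elliptic_orbit
begin

lemma du_complex: "((\<lambda>z. complex_of_real (u z)) has_vector_derivative of_real (u' z)) (at z)"
  and du'_complex: "((\<lambda>z. complex_of_real (u' z)) has_vector_derivative
    of_real g * (1 - 2 * of_real e * of_real (u z) - 3 * (of_real (u z))\<^sup>2)) (at z)"
  using bounded_linear.has_vector_derivative[OF bounded_linear_of_real du[unfolded has_real_derivative_iff_has_vector_derivative]]
   bounded_linear.has_vector_derivative[OF bounded_linear_of_real du'[unfolded has_real_derivative_iff_has_vector_derivative]]
  by simp_all

lemma continuous_on_u: "continuous_on S u" and continuous_on_u': "continuous_on S u'"
  using continuous_u continuous_u' by (simp_all add: continuous_at_imp_continuous_on)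

lemma inverse_shift_has_vector_derivative:
  assumes "complex_of_real (u z) + b \<noteq> 0"
  shows "((\<lambda>z. 1 / (complex_of_real (u z) + b)) has_vector_derivative
           - of_real (u' z) * (1 / (complex_of_real (u z) + b))\<^sup>2) (at z)"
proof -
  have "((\<lambda>x. 1 / x) has_field_derivative - (1 / (complex_of_real (u z) + b))\<^sup>2) (at (complex_of_real (u z) + b))"
    using assms by (auto intro!: derivative_eq_intros simp: power2_eq_square)
  from field_vector_diff_chain_at[OF has_vector_derivative_add[OF du_complex has_vector_derivative_const] this]
  show ?thesis by (simp add: o_def)
qed

text \<open>
  The products of solutions of the Hill equation \<open>q'' + g u q = g\<^sup>2 l\<^sup>2 q\<close> contain the function
  \<open>w = u + b\<close>; a solution with Wronskian \<open>W = 2 g l s\<close> is \<open>exp (\<integral> (w' + W) / (2 w))\<close>.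
  The term \<open>g l c\<close> undoes the removal of the first-order term.
\<close>
lemma floquet_solution:
  fixes l s b :: complex and c T :: real
  assumes b: "b = of_real e + 2 * of_real g * l\<^sup>2" and s: "s\<^sup>2 = b\<^sup>2 - 1"
    and nz: "\<And>z. complex_of_real (u z) + b \<noteq> 0" and gc: "g * (c\<^sup>2 - 1) = 1"
    and T: "T > 0" and per: "\<And>z. u (z + T) = u z"
    and balance: "Re (l * (of_real (c * T) + s * integral {0..T} (\<lambda>z. 1 / (complex_of_real (u z) + b)))) = 0"
  shows "\<exists>(p::real \<Rightarrow> complex) p' p''.
     (\<forall>z. (p has_vector_derivative p' z) (at z)) \<and> (\<forall>z. (p' has_vector_derivative p'' z) (at z)) \<and>
     (\<forall>z. p'' z - 2 * of_real c * of_real g * l * p' z + of_real g * (l\<^sup>2 + of_real (u z)) * p z = 0) \<and>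
     bounded (range p) \<and> (\<exists>z. p z \<noteq> 0)"
proof -
  define w where "w = (\<lambda>z. complex_of_real (u z) + b)"
  define v where "v = (\<lambda>z. 1 / w z)"
  have wv: "v z * w z = 1" for z using nz unfolding v_def w_def by simp
  have w0: "w z \<noteq> 0" for z using nz unfolding w_def by simp
  have cu: "continuous_on UNIV (\<lambda>z. complex_of_real (u z))" "continuous_on UNIV (\<lambda>z. complex_of_real (u' z))"
    by (intro continuous_intros continuous_on_u continuous_on_u')+
  have cw: "continuous_on UNIV w" unfolding w_def by (intro continuous_intros cu)
  have cv: "continuous_on UNIV v" unfolding v_def using w0 by (intro continuous_intros cw) auto
  obtain S where S: "\<And>z. (S has_vector_derivative v z) (at z)"
    using continuous_imp_antiderivative[OF cv] by blast
  obtain L where L0: "L 0 = 0" and L: "\<And>z. (L has_vector_derivative of_real (u' z) * v z) (at z)"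
    using continuous_imp_antiderivative[of "\<lambda>z. of_real (u' z) * v z"] cu(2) cv continuous_on_mult by blast
  have dw: "(w has_vector_derivative of_real (u' z)) (at z)" for z
    unfolding w_def using has_vector_derivative_add[OF du_complex has_vector_derivative_const] by simp
  have dv: "(v has_vector_derivative - of_real (u' z) * (v z)\<^sup>2) (at z)" for z
    unfolding v_def w_def by (rule inverse_shift_has_vector_derivative[OF nz])
  have id: "((\<lambda>z. complex_of_real z) has_vector_derivative 1) (at z)" for z
    using has_vector_derivative_of_real[of "\<lambda>z. z" 1] by (auto intro!: derivative_eq_intros)
  define G where "G = of_real g * l"
  define p where "p = (\<lambda>z. exp (L z / 2 + G * (of_real c * of_real z + s * S z)))"
  define r where "r = (\<lambda>z. of_real (u' z) * v z / 2 + G * (of_real c + s * v z))"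
  define r' where "r' = (\<lambda>z. (of_real (u' z) * (- of_real (u' z) * (v z)\<^sup>2)
      + of_real g * (1 - 2 * of_real e * of_real (u z) - 3 * (of_real (u z))\<^sup>2) * v z) / 2 + G * (s * (- of_real (u' z) * (v z)\<^sup>2)))"
  have cs: "((\<lambda>z. of_real c + s * v z) has_vector_derivative s * (- of_real (u' z) * (v z)\<^sup>2)) (at z)" for z
    using has_vector_derivative_add[OF has_vector_derivative_const has_vector_derivative_mult_right[OF dv]] by simp
  have r: "(r has_vector_derivative r' z) (at z)" for z
    unfolding r_def r'_def
    by (intro has_vector_derivative_add has_vector_derivative_mult_right has_vector_derivative_divide
        has_vector_derivative_mult cs du'_complex dv)
  have "((\<lambda>z. L z / 2 + G * (of_real c * of_real z + s * S z)) has_vector_derivative r z) (at z)" for z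
  proof (rule has_vector_derivative_eq_rhs)
    show "((\<lambda>z. L z / 2 + G * (of_real c * of_real z + s * S z)) has_vector_derivative
      (of_real (u' z) * v z / 2 + G * (of_real c * 1 + s * v z))) (at z)"
      by (intro has_vector_derivative_add has_vector_derivative_mult_right has_vector_derivative_divide L S id)
  qed (simp add: r_def)
  then have p: "(p has_vector_derivative r z * p z) (at z)" for z
    unfolding p_def by (rule exp_has_vector_derivative)
  have p': "((\<lambda>z. r z * p z) has_vector_derivative (r z * (r z * p z) + r' z * p z)) (at z)" for z
    by (intro has_vector_derivative_mult r p)
  have riccati: "r' z + (r z)\<^sup>2 - 2 * of_real c * G * r z + of_real g * (l\<^sup>2 + of_real (u z)) = 0" for z
  proof -
    have "(complex_of_real (u' z))\<^sup>2 = 2 * of_real g * (1 - (of_real (u z))\<^sup>2) * (of_real e + of_real (u z))"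
      using arg_cong[OF first_integral[of z], of complex_of_real] by simp
    moreover have "complex_of_real g * ((of_real c)\<^sup>2 - 1) = 1"
      using arg_cong[OF gc, of complex_of_real] by simp
    ultimately show ?thesis
      unfolding r'_def r_def G_def by (rule riccati_identity[OF _ _ b s _ wv]) (simp only: w_def)
  qed
  have "bounded (range p)"
  proof -
    \<comment> \<open>\<open>L\<close> is an antiderivative of \<open>w' / w\<close>, so
      \<open>exp L\<close> equals \<open>w / w 0\<close> without any choice of a complex
      logarithm.\<close>
    have "((\<lambda>z. exp (- L z) * w z) has_vector_derivative 0) (at z)" for z
    proof (rule has_vector_derivative_eq_rhs)
      show "((\<lambda>z. exp (- L z) * w z) has_vector_derivative
        (exp (- L z) * of_real (u' z) + (- (of_real (u' z) * v z) * exp (- L z)) * w z)) (at z)"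
        by (intro has_vector_derivative_mult dw exp_has_vector_derivative has_vector_derivative_minus L)
      show "exp (- L z) * of_real (u' z) + (- (of_real (u' z) * v z) * exp (- L z)) * w z = 0"
        using wv[of z] by algebra
    qed
    then obtain k where k: "\<And>z. exp (- L z) * w z = k"
      using has_vector_derivative_zero_constant[of UNIV "\<lambda>z. exp (- L z) * w z"] by auto
    have k0: "k = w 0" using k[of 0] L0 by simp
    have expL: "exp (L z) = w z / w 0" for z
      using k[of z] w0[of 0] unfolding k0 by (simp add: exp_minus field_simps)
    have Sper: "S (z + T) = S z + integral {0..T} v" for z
      using antiderivative_eq_integral[of S v T z] S T per unfolding v_def w_def by (simp add: algebra_simps)
    define h where "h = (\<lambda>z. Re (l * (of_real c * of_real z + s * S z)))"
    have hper: "h (z + T) = h z" for z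
    proof -
      have "h (z + T) = h z + Re (l * (of_real (c * T) + s * integral {0..T} v))"
        unfolding h_def Sper by (simp add: algebra_simps)
      then show ?thesis using balance unfolding v_def w_def by simp
    qed
    \<comment> \<open>Only the modulus of \<open>p\<close> has to be periodic: \<open>|p|^2\<close>
      is built from the periodic \<open>|w|\<close> and from \<open>h\<close>, which is periodic by
      \<open>balance\<close>.\<close>
    have sq: "(norm (p z))\<^sup>2 = norm (w z) / norm (w 0) * exp (2 * g * h z)" for z
    proof -
      have "(p z)\<^sup>2 = exp (L z) * exp (2 * G * (of_real c * of_real z + s * S z))"
        unfolding p_def exp_add[symmetric] exp_double[symmetric] by (simp add: algebra_simps)
      then have "norm ((p z)\<^sup>2) = norm (w z / w 0) * norm (exp (2 * G * (of_real c * of_real z + s * S z)))"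
        by (metis expL norm_mult)
      moreover have "Re (2 * G * (of_real c * of_real z + s * S z)) = 2 * g * h z"
        unfolding G_def h_def by (simp add: algebra_simps)
      ultimately show ?thesis unfolding norm_power norm_divide norm_exp_eq_Re by simp
    qed
    have cp: "continuous_on UNIV p"
      using p has_vector_derivative_continuous by (blast intro: continuous_at_imp_continuous_on)
    have "w (z + T) = w z" for z unfolding w_def per ..
    then have "bounded (range (\<lambda>z. complex_of_real ((norm (p z))\<^sup>2)))"
      by (intro periodic_continuous_bounded[OF _ T] continuous_intros cp) (simp add: sq hper)
    then obtain M where M: "\<And>z. (norm (p z))\<^sup>2 \<le> M" unfolding bounded_iff by (auto simp: norm_power)
    have "norm (p z) \<le> sqrt M" for z using M real_le_rsqrt by blast
    then show ?thesis unfolding bounded_iff by blast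
  qed
  moreover have "(r z * (r z * p z) + r' z * p z) - 2 * of_real c * of_real g * l * (r z * p z)
       + of_real g * (l\<^sup>2 + of_real (u z)) * p z = 0" for z
  proof -
    have "(r z * (r z * p z) + r' z * p z) - 2 * of_real c * of_real g * l * (r z * p z)
       + of_real g * (l\<^sup>2 + of_real (u z)) * p z
      = (r' z + (r z)\<^sup>2 - 2 * of_real c * G * r z + of_real g * (l\<^sup>2 + of_real (u z))) * p z"
      unfolding G_def by algebra
    then show ?thesis unfolding riccati by simp
  qed
  moreover have "p 0 \<noteq> 0" unfolding p_def by simp
  ultimately show ?thesis using p p'
    by (intro exI[of _ p] exI[of _ "\<lambda>z. r z * p z"] exI[of _ "\<lambda>z. r z * (r z * p z) + r' z * p z"]) blast
qed

section \<open>Integrals over a period\<close>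

text \<open>If the mean were 1, then \<open>u = 1\<close> and \<open>u' = 0\<close> on the whole
  interval, while the derivative of \<open>u'\<close> at the value 1 is
  \<open>- 2 * g * (1 + e)\<close>, which is nonzero. The strict inequality supplies the negative
  sign at the band edge \<open>b = -1\<close>.\<close>

lemma mean_less_one:
  assumes "T > 0"
  shows "integral {0..T} u < T"
proof -
  have int: "u integrable_on {0..T}" "(\<lambda>z. 1 - u z) integrable_on {0..T}"
    by (intro integrable_continuous_real continuous_intros continuous_on_u)+
  have eq: "integral {0..T} (\<lambda>z. 1 - u z) = T - integral {0..T} u"
    using assms int by (subst Henstock_Kurzweil_Integration.integral_diff) auto
  have "integral {0..T} (\<lambda>z. 1 - u z) \<noteq> 0"
  proof
    assume "integral {0..T} (\<lambda>z. 1 - u z) = 0"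
    then have one: "u z = 1" if "z \<in> {0..T}" for z
      using integral_eq_0_iff[of 0 T "\<lambda>z. 1 - u z"] assms u_bound that
      by (force simp: abs_le_iff intro!: continuous_intros continuous_on_u)
    have crit: "u' z = 0" if "z \<in> {0..T}" for z
      using first_integral[of z] one[OF that] by simp
    obtain z where "0 < z" "z < T" "u' T - u' 0 = (T - 0) * (g * (1 - 2 * e * u z - 3 * (u z)\<^sup>2))"
      using MVT2[of 0 T u' "\<lambda>z. g * (1 - 2 * e * u z - 3 * (u z)\<^sup>2)"] assms du' by auto
    then show False using crit[of 0] crit[of T] one[of z] assms g_nz simple_roots by auto
  qed
  moreover have "integral {0..T} (\<lambda>z. 1 - u z) \<ge> 0"
    using int u_bound by (intro integral_nonneg) (auto simp: abs_le_iff)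
  ultimately show ?thesis using eq by linarith
qed

lemma deriv_periodic:
  assumes "\<And>z. u (z + T) = u z"
  shows "u' (z + T) = u' z"
proof -
  have "((\<lambda>z. u (z + T)) has_real_derivative u' (z + T)) (at z)"
    by (rule DERIV_cong[OF DERIV_chain2[OF du]]) (auto intro!: derivative_eq_intros)
  then have "(u has_real_derivative u' (z + T)) (at z)" unfolding assms by simp
  then show ?thesis using du DERIV_unique by blast
qed

text \<open>Integrate the derivative of the periodic function \<open>- u' / (u + b)\<close> over a period.\<close>
lemma period_relation:
  fixes b :: complex
  assumes nz: "\<And>z. complex_of_real (u z) + b \<noteq> 0" and T: "T > 0" and per: "\<And>z. u (z + T) = u z"
  shows "2 * (b - of_real e) * (b\<^sup>2 - 1) * integral {0..T} (\<lambda>z. (1 / (complex_of_real (u z) + b))\<^sup>2)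
    + (1 + 2 * of_real e * b - 3 * b\<^sup>2) * integral {0..T} (\<lambda>z. 1 / (complex_of_real (u z) + b))
    + (of_real (integral {0..T} u) + b * of_real T) = 0"
proof -
  define v where "v = (\<lambda>z. 1 / (complex_of_real (u z) + b))"
  define X where "X = (\<lambda>z. - (complex_of_real (u' z) * v z))"
  \<comment> \<open>Expansion coefficients at \<open>-b\<close>: \<open>?k2\<close> is the value
    there of the cubic \<open>2 * (1 - U^2) * (e + U)\<close>, and \<open>?k1\<close> is half its
    derivative there.\<close>
  let ?k2 = "2 * (b - of_real e) * (b\<^sup>2 - 1)" and ?k1 = "1 + 2 * of_real e * b - 3 * b\<^sup>2"
  have cu: "continuous_on S (\<lambda>z. complex_of_real (u z))" for S by (intro continuous_intros continuous_on_u)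
  have cv: "continuous_on S v" for S unfolding v_def using nz by (intro continuous_intros cu) auto
  have vw: "v z * (complex_of_real (u z) + b) = 1" for z unfolding v_def using nz by simp
  have "(X has_vector_derivative
      of_real g * (?k2 * (v z)\<^sup>2 + ?k1 * v z + (of_real (u z) + b))) (at z)" for z
  proof (rule has_vector_derivative_eq_rhs)
    show "(X has_vector_derivative - (complex_of_real (u' z) * (- of_real (u' z) * (v z)\<^sup>2)
      + of_real g * (1 - 2 * of_real e * of_real (u z) - 3 * (of_real (u z))\<^sup>2) * v z)) (at z)"
      unfolding X_def v_def
      by (intro has_vector_derivative_minus has_vector_derivative_mult inverse_shift_has_vector_derivative nz du'_complex)
    have "(complex_of_real (u' z))\<^sup>2 = 2 * of_real g * (1 - (of_real (u z))\<^sup>2) * (of_real e + of_real (u z))"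
      using arg_cong[OF first_integral[of z], of complex_of_real] by simp
    then show "- (complex_of_real (u' z) * (- of_real (u' z) * (v z)\<^sup>2)
      + of_real g * (1 - 2 * of_real e * of_real (u z) - 3 * (of_real (u z))\<^sup>2) * v z)
      = of_real g * (?k2 * (v z)\<^sup>2 + ?k1 * v z + (of_real (u z) + b))"
      using vw[of z] by algebra
  qed
  then have "((\<lambda>z. of_real g * (?k2 * (v z)\<^sup>2 + ?k1 * v z + (of_real (u z) + b))) has_integral (X T - X 0)) {0..T}"
    using T by (intro fundamental_theorem_of_calculus) (auto intro: has_vector_derivative_at_within)
  moreover have "X T = X 0"
    using per[of 0] deriv_periodic[OF per, of 0] unfolding X_def v_def by simp
  ultimately have zero: "((\<lambda>z. of_real g * (?k2 * (v z)\<^sup>2 + ?k1 * v z + (of_real (u z) + b))) has_integral 0) {0..T}"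
    by simp
  have "((\<lambda>z. b) has_integral b * of_real T) {0..T}"
    using has_integral_const_real[of b 0 T] T by (simp add: scaleR_conv_of_real mult.commute)
  then have "((\<lambda>z. of_real g * (?k2 * (v z)\<^sup>2 + ?k1 * v z + (of_real (u z) + b))) has_integral
     of_real g * (?k2 * integral {0..T} (\<lambda>z. (v z)\<^sup>2) + ?k1 * integral {0..T} v
       + (of_real (integral {0..T} u) + b * of_real T))) {0..T}"
    by (intro has_integral_mult_right has_integral_add has_integral_of_real integrable_integral
      integrable_continuous_real continuous_intros cv continuous_on_u)
  from has_integral_unique[OF this zero] show ?thesis using g_nz unfolding v_def by simp
qed

section \<open>Spectral points in the right half plane\<close>

text \<open>
  Write \<open>K\<close> for \<open>l s\<close> times the integral of \<open>1 / (u + b)\<close>. At an imaginary \<open>l\<close> with \<open>b < -1\<close> (inside a band)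
  \<open>Re K = 0\<close>, and by \<open>period_relation\<close> the derivative of \<open>K\<close> in \<open>l\<close> is the integral of \<open>u + b\<close>
  divided by \<open>s\<close>, which tends to \<open>- \<infinity>\<close> at the band edge \<open>b = -1\<close>. So if \<open>l\<close> starts close enough to the edge
  and moves to the right, \<open>Re (l C T + K)\<close> is first negative; far to the right \<open>C > 1\<close> makes it positive.
\<close>
lemma balance_superluminal:
  assumes g: "g > 0" and e: "e > - 1" and C: "C > 1" and T: "T > 0" and per: "\<And>z. u (z + T) = u z"
  shows "\<exists>l s b. Re l > 0 \<and> b = of_real e + 2 * of_real g * l\<^sup>2 \<and> s\<^sup>2 = b\<^sup>2 - 1 \<and>
    (\<forall>z. complex_of_real (u z) + b \<noteq> 0) \<and>
    Re (l * (of_real (C * T) + s * integral {0..T} (\<lambda>z. 1 / (complex_of_real (u z) + b)))) = 0"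
proof -
  define U where "U = integral {0..T} u"
  \<comment> \<open>As \<open>b\<close> tends to -1 from the left the expression tends to
    \<open>U - T\<close>, negative by \<open>mean_less_one\<close>. Divided by
    \<open>sqrt (b0^2 - 1)\<close>, it becomes the derivative of \<open>\<Psi>\<close> at 0.\<close>
  have "\<exists>b0 < - 1. C * T * sqrt (b0\<^sup>2 - 1) + U + T * b0 < 0"
  proof -
    let ?h = "\<lambda>b. C * T * sqrt (b\<^sup>2 - 1) + U + T * b"
    have "(?h \<longlongrightarrow> ?h (- 1)) (at_left (- 1))" by (intro tendsto_intros)
    moreover have "?h (- 1) < 0" using mean_less_one[OF T] unfolding U_def by simp
    ultimately have "\<forall>\<^sub>F b in at_left (- 1). ?h b < 0" by (rule order_tendstoD)
    moreover have "\<forall>\<^sub>F b::real in at_left (- 1). b < - 1" by (simp add: eventually_at_filter)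
    ultimately have "\<forall>\<^sub>F b in at_left (- 1). b < - 1 \<and> ?h b < 0" by eventually_elim simp
    then show ?thesis using eventually_happens'[OF trivial_limit_at_left_real] by blast
  qed
  then obtain b0 where b0: "b0 < - 1" and hb0: "C * T * sqrt (b0\<^sup>2 - 1) + U + T * b0 < 0" by blast
  \<comment> \<open>Chosen so that \<open>l = \<i> * y\<close> corresponds to \<open>b = b0\<close>;
    then \<open>l\<close> moves right along the horizontal line through this point.\<close>
  define y where "y = sqrt ((e - b0) / (2 * g))"
  have y: "y > 0" unfolding y_def using e b0 g by simp
  have y2: "2 * g * y\<^sup>2 = e - b0" unfolding y_def using e b0 g by simp
  define l where "l = (\<lambda>x. complex_of_real x + \<i> * of_real y)"
  define b where "b = (\<lambda>x. of_real e + 2 * of_real g * (l x)\<^sup>2)"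
  \<comment> \<open>The two factors keep their arguments off the branch cut for all
    \<open>x \<ge> 0\<close>, where \<open>b x\<close> is \<open>b0\<close> or lies in the upper
    half plane. A single root of \<open>b^2 - 1\<close> would meet the cut when \<open>b\<close>
    becomes imaginary.\<close>
  define s where "s = (\<lambda>x. csqrt (1 - b x) * csqrt (- 1 - b x))"
  have Imb: "Im (b x) = 4 * g * x * y" and Reb: "Re (b x) = b0 + 2 * g * x\<^sup>2" for x
    using y2 unfolding b_def l_def by (simp_all add: power2_eq_square algebra_simps)
  have bzero: "b 0 = of_real b0" using Imb[of 0] Reb[of 0] by (simp add: complex_eq_iff)
  have Imb': "x = 0 \<or> Im (b x) > 0" if "x \<ge> 0" for x using that g y unfolding Imb by (cases "x = 0") auto
  have s2: "(s x)\<^sup>2 = (b x)\<^sup>2 - 1" for x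
    unfolding s_def power_mult_distrib power2_csqrt by (simp add: algebra_simps power2_eq_square)
  have nonreal: "1 - b x \<notin> \<real>\<^sub>\<le>\<^sub>0" "- 1 - b x \<notin> \<real>\<^sub>\<le>\<^sub>0" if "x \<ge> 0" for x
    using Imb'[OF that] b0 bzero by (auto simp: complex_nonpos_Reals_iff)
  have nz: "complex_of_real (u z) + b x \<noteq> 0" if "x \<ge> 0" for x z
    using Imb'[OF that]
  proof
    assume "x = 0"
    then show ?thesis using bzero b0 u_bound[of z] by (auto simp: complex_eq_iff)
  qed (auto simp: complex_eq_iff)
  have s0: "s x \<noteq> 0" if "x \<ge> 0" for x
  proof -
    have "1 - b x \<noteq> 0" "- 1 - b x \<noteq> 0" using nonreal[OF that] nonpos_Reals_zero_I by metis+
    then show ?thesis unfolding s_def mult_eq_0_iff csqrt_eq_0 by blast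
  qed
  have dl: "(l has_vector_derivative 1) (at x within S)" for x S
  proof -
    have "(complex_of_real has_vector_derivative 1) (at x within S)"
      using has_vector_derivative_of_real[of "\<lambda>z. z" 1 "at x within S"] by (auto intro!: derivative_eq_intros)
    from has_vector_derivative_add[OF this has_vector_derivative_const] show ?thesis unfolding l_def by simp
  qed
  have db: "(b has_vector_derivative 4 * of_real g * l x) (at x within S)" for x S
    unfolding b_def power2_eq_square
  proof (rule has_vector_derivative_eq_rhs)
    show "((\<lambda>x. complex_of_real e + 2 * of_real g * (l x * l x)) has_vector_derivative
        0 + 2 * of_real g * (l x * 1 + 1 * l x)) (at x within S)"
      by (intro has_vector_derivative_add has_vector_derivative_mult_right
        has_vector_derivative_mult has_vector_derivative_const dl)
  qed simp
  have ds: "(s has_vector_derivative 4 * of_real g * l x * b x / s x) (at x within S)" if x: "x \<ge> 0" for x S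
  proof -
    have "((\<lambda>z. csqrt (1 - z) * csqrt (- 1 - z)) has_field_derivative b x / s x) (at (b x) within b ` S)"
      using nonreal[OF x] s0[OF x] unfolding s_def
      by (auto intro!: derivative_eq_intros simp: field_simps power2_eq_square[symmetric])
    from field_vector_diff_chain_within[OF db this] show ?thesis
      by (simp add: o_def s_def)
  qed
  let ?f = "\<lambda>x t. 1 / (complex_of_real (u t) + b x)"
  let ?f' = "\<lambda>x t. - (4 * of_real g * l x) * (?f x t)\<^sup>2"
  define I where "I = (\<lambda>x. integral {0..T} (?f x))"
  have cont_u2: "continuous_on (S \<times> R) (\<lambda>p. complex_of_real (u (snd p)))" for S :: "real set" and R
    by (intro continuous_intros continuous_on_compose2[OF continuous_on_u[of UNIV]]) auto
  have cont_b2: "continuous_on (S \<times> R) (\<lambda>p. b (fst p))" "continuous_on (S \<times> R) (\<lambda>p. l (fst p))" for S and R :: "real set"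
    unfolding b_def l_def by (intro continuous_intros)+
  have dI: "(I has_vector_derivative - (4 * of_real g * l x) * integral {0..T} (\<lambda>t. (?f x t)\<^sup>2)) (at x within {0..})"
    if x: "x \<ge> 0" for x
  proof -
    have "((\<lambda>x. integral (cbox 0 T) (?f x)) has_vector_derivative integral (cbox 0 T) (?f' x)) (at x within {0..})"
    proof (rule leibniz_rule_vector_derivative)
      fix x t :: real assume "x \<in> {0..}"
      then have n: "complex_of_real (u t) + b x \<noteq> 0" using nz by simp
      have "((\<lambda>z. 1 / (complex_of_real (u t) + z)) has_field_derivative - (?f x t)\<^sup>2) (at (b x) within b ` {0..})"
        using n by (auto intro!: derivative_eq_intros simp: power2_eq_square)
      from field_vector_diff_chain_within[OF db this]
      show "((\<lambda>x. ?f x t) has_vector_derivative ?f' x t) (at x within {0..})" by (simp add: o_def)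
    next
      fix x :: real assume "x \<in> {0..}"
      then show "?f x integrable_on cbox 0 T" using nz
        by (auto intro!: integrable_continuous_real continuous_intros continuous_on_u)
    next
      show "continuous_on ({0..} \<times> cbox 0 T) (\<lambda>(x, t). ?f' x t)"
        unfolding split_beta using nz
        by (intro continuous_intros cont_u2 cont_b2) auto
    qed (use x in auto)
    then show ?thesis unfolding I_def by simp
  qed
  define N where "N = (\<lambda>x. l x * (s x * I x))"
  define \<Psi> where "\<Psi> = (\<lambda>x. C * T * x + Re (N x))"
  have dN: "(N has_vector_derivative
      l x * (s x * (- (4 * of_real g * l x) * integral {0..T} (\<lambda>t. (?f x t)\<^sup>2)) + 4 * of_real g * l x * b x / s x * I x)
        + 1 * (s x * I x)) (at x within {0..})" if "x \<ge> 0" for x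
    unfolding N_def using that by (intro has_vector_derivative_mult dl ds dI)
  have d\<Psi>: "(\<Psi> has_real_derivative C * T + Re D) (at x within {0..})"
    if "(N has_vector_derivative D) (at x within {0..})" for x D
    unfolding \<Psi>_def has_real_derivative_iff_has_vector_derivative
    by (intro has_vector_derivative_add bounded_linear.has_vector_derivative[OF bounded_linear_Re that])
      (auto intro!: derivative_eq_intros)
  have I0: "I 0 = of_real (integral {0..T} (\<lambda>z. 1 / (u z + b0)))"
  proof -
    have "u z + b0 \<noteq> 0" for z using u_bound[of z] b0 by auto
    then have "(\<lambda>z. 1 / (u z + b0)) integrable_on {0..T}"
      by (intro integrable_continuous_real continuous_intros continuous_on_u) auto
    from has_integral_of_real[OF integrable_integral[OF this], where 'b = complex]
    show ?thesis unfolding I_def bzero by (simp add: integral_unique)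
  qed
  have "sqrt (1 - b0) * sqrt (- 1 - b0) = sqrt (b0\<^sup>2 - 1)"
    unfolding real_sqrt_mult[symmetric] by (simp add: algebra_simps power2_eq_square)
  then have szero: "s 0 = of_real (sqrt (b0\<^sup>2 - 1))"
    unfolding s_def bzero using b0 by (simp flip: of_real_mult)
  have r0: "sqrt (b0\<^sup>2 - 1) > 0" using b0 one_less_power[of "- b0" 2] by simp
  \<comment> \<open>\<open>l 0\<close> is imaginary, while \<open>s 0\<close> and \<open>I 0\<close>
    are real.\<close>
  have \<Psi>0: "\<Psi> 0 = 0" unfolding \<Psi>_def N_def I0 szero l_def by simp
  have "\<exists>D. (\<Psi> has_real_derivative D) (at 0 within {0..}) \<and> D < 0"
  proof -
    define J where "J = integral {0..T} (\<lambda>t. (?f 0 t)\<^sup>2)"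
    have rel: "2 * (b 0 - of_real e) * ((b 0)\<^sup>2 - 1) * J + (1 + 2 * of_real e * b 0 - 3 * (b 0)\<^sup>2) * I 0
       + (of_real U + b 0 * of_real T) = 0"
      using period_relation[OF nz T per, of 0] unfolding J_def I_def U_def by simp
    \<comment> \<open>The derivative of \<open>N\<close> at 0. After multiplication by
      \<open>s 0\<close>, the period relation eliminates both \<open>J\<close> and
      \<open>I 0\<close>.\<close>
    let ?D = "l 0 * (s 0 * (- (4 * of_real g * l 0) * J) + 4 * of_real g * l 0 * b 0 / s 0 * I 0) + 1 * (s 0 * I 0)"
    have l2: "2 * of_real g * (l 0)\<^sup>2 = b 0 - of_real e" unfolding b_def by simp
    have "?D * s 0 = - (2 * (2 * of_real g * (l 0)\<^sup>2)) * (s 0)\<^sup>2 * J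
        + 2 * (2 * of_real g * (l 0)\<^sup>2) * b 0 * I 0 + (s 0)\<^sup>2 * I 0"
      using s0[of 0] by (simp add: field_simps power2_eq_square)
    also have "\<dots> = of_real U + b 0 * of_real T" unfolding l2 s2 using rel by algebra
    finally have "?D * s 0 = of_real U + b 0 * of_real T" .
    then have "?D = (of_real U + b 0 * of_real T) / s 0"
      by (rule iffD2[OF nonzero_eq_divide_eq[OF s0[OF order_refl]]])
    also have "\<dots> = of_real ((U + b0 * T) / sqrt (b0\<^sup>2 - 1))" unfolding szero bzero by simp
    finally have "(\<Psi> has_real_derivative C * T + Re (of_real ((U + b0 * T) / sqrt (b0\<^sup>2 - 1)))) (at 0 within {0..})"
      using d\<Psi>[OF dN[of 0]] unfolding J_def by simp
    moreover have "C * T + (U + b0 * T) / sqrt (b0\<^sup>2 - 1) < 0"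
      using r0 hb0 by (simp add: field_simps)
    ultimately show ?thesis by auto
  qed
  then obtain D where D: "(\<Psi> has_real_derivative D) (at 0 within {0..})" "D < 0" by blast
  obtain d where d: "d > 0" and dec: "\<And>h. h > 0 \<Longrightarrow> 0 + h \<in> {0..} \<Longrightarrow> h < d \<Longrightarrow> \<Psi> (0 + h) < \<Psi> 0"
    using has_real_derivative_neg_dec_right[OF D] by blast
  define x1 where "x1 = d / 2"
  have x1: "x1 > 0" "\<Psi> x1 < 0" using dec[of "d / 2"] d \<Psi>0 unfolding x1_def by auto
  \<comment> \<open>This expression, at \<open>x2\<close>, will bound
    \<open>norm (N x2) / (x2 * T)\<close>; its limit 1 lies below \<open>C\<close>, so the term
    \<open>C * T * x\<close> wins far to the right.\<close>
  have "((\<lambda>x. (x + y) / x * (1 + 2 / (b0 + 2 * g * x\<^sup>2 - 1))) \<longlongrightarrow> 1) at_top"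
    using g by real_asymp
  then have "\<forall>\<^sub>F x in at_top. (x + y) / x * (1 + 2 / (b0 + 2 * g * x\<^sup>2 - 1)) < C"
    using C by (rule order_tendstoD)
  moreover have "filterlim (\<lambda>x. b0 + 2 * g * x\<^sup>2) at_top at_top" using g by real_asymp
  then have "\<forall>\<^sub>F x in at_top. b0 + 2 * g * x\<^sup>2 > 1" by (simp add: filterlim_at_top_dense)
  ultimately have "\<forall>\<^sub>F x in at_top. x > x1 \<and> b0 + 2 * g * x\<^sup>2 > 1 \<and>
      (x + y) / x * (1 + 2 / (b0 + 2 * g * x\<^sup>2 - 1)) < C"
    using eventually_gt_at_top[of x1] by eventually_elim simp
  then obtain x2 where x2: "x2 > x1" "b0 + 2 * g * x2\<^sup>2 > 1"
      "(x2 + y) / x2 * (1 + 2 / (b0 + 2 * g * x2\<^sup>2 - 1)) < C"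
    using eventually_happens'[OF trivial_limit_at_top_linorder] by blast
  have "\<Psi> x2 > 0"
  proof -
    define \<beta> where "\<beta> = b0 + 2 * g * x2\<^sup>2"
    define n where "n = norm (b x2)"
    have n: "n \<ge> \<beta>" unfolding n_def \<beta>_def using complex_Re_le_cmod[of "b x2"] Reb[of x2] by simp
    have \<beta>: "\<beta> > 1" using x2(2) unfolding \<beta>_def .
    have x2p: "x2 > 0" using x1 x2 by simp
    have "norm (I x2) \<le> 1 / (n - 1) * (T - 0)"
      unfolding I_def
    proof (rule integral_bound)
      show "continuous_on {0..T} (?f x2)"
        using nz[of x2] x2p by (intro continuous_intros continuous_on_u) auto
      fix t
      have "norm (b x2) - norm (complex_of_real (- u t)) \<le> norm (b x2 - complex_of_real (- u t))" by (rule norm_triangle_ineq2)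
      then have "n - 1 \<le> norm (complex_of_real (u t) + b x2)"
        using u_bound[of t] unfolding n_def by (simp add: add.commute)
      then show "norm (?f x2 t) \<le> 1 / (n - 1)"
        using n \<beta> by (simp add: norm_divide frac_le)
    qed (use T in simp)
    moreover have "norm (s x2) \<le> n + 1"
    proof (rule power2_le_imp_le)
      have "(norm (s x2))\<^sup>2 \<le> n\<^sup>2 + 1"
        using norm_triangle_ineq4[of "(b x2)\<^sup>2" 1] s2[of x2] unfolding n_def by (metis norm_one norm_power)
      also have "\<dots> \<le> (n + 1)\<^sup>2" using n \<beta> by (simp add: power2_sum)
      finally show "(norm (s x2))\<^sup>2 \<le> (n + 1)\<^sup>2" .
    qed (use n \<beta> in simp)
    moreover have "norm (l x2) \<le> x2 + y"
      unfolding l_def using norm_triangle_ineq[of "complex_of_real x2" "\<i> * of_real y"] x2p y by (simp add: norm_mult)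
    ultimately have "norm (N x2) \<le> (x2 + y) * ((n + 1) * (1 / (n - 1) * (T - 0)))"
      unfolding N_def norm_mult using x2p y n \<beta> T by (intro mult_mono) auto
    also have "(n + 1) * (1 / (n - 1) * (T - 0)) = (1 + 2 / (n - 1)) * T" using n \<beta> by (simp add: field_simps)
    also have "(x2 + y) * ((1 + 2 / (n - 1)) * T) \<le> (x2 + y) * ((1 + 2 / (\<beta> - 1)) * T)"
      using n \<beta> x2p y T by (intro mult_left_mono mult_right_mono add_left_mono frac_le) auto
    also have "\<dots> = ((x2 + y) / x2 * (1 + 2 / (\<beta> - 1))) * (x2 * T)" using x2p by simp
    also have "\<dots> < C * (x2 * T)"
      using x2(3) x2p T unfolding \<beta>_def by (intro mult_strict_right_mono) auto
    finally have "norm (N x2) < C * T * x2" by (simp add: mult_ac)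
    then show ?thesis unfolding \<Psi>_def using abs_Re_le_cmod[of "N x2"] by linarith
  qed
  moreover have "continuous_on {x1..x2} \<Psi>"
  proof (rule continuous_on_subset)
    show "continuous_on {0..} \<Psi>"
      unfolding continuous_on_eq_continuous_within using d\<Psi>[OF dN] DERIV_continuous by blast
  qed (use x1 in auto)
  ultimately obtain x where x: "x1 \<le> x" "\<Psi> x = 0"
    using IVT'[of \<Psi> x1 0 x2] x1 x2 by auto
  have "Re (l x * (of_real (C * T) + s x * I x)) = C * T * x + Re (N x)"
    unfolding N_def by (simp add: l_def algebra_simps)
  then have "Re (l x * (of_real (C * T) + s x * I x)) = 0" using x(2) unfolding \<Psi>_def by simp
  moreover have "Re (l x) > 0" using x(1) x1 unfolding l_def by simp
  moreover have "\<forall>z. complex_of_real (u z) + b x \<noteq> 0" using x(1) x1(1) nz[of x] by simp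
  moreover have "b x = of_real e + 2 * of_real g * (l x)\<^sup>2" unfolding b_def ..
  ultimately show ?thesis using s2[of x] unfolding I_def by blast
qed

text \<open>
  Here \<open>l\<close> is real: the balance is \<open>C T \<ge> 0\<close> at \<open>b = -1\<close> and negative for \<open>b\<close> near \<open>- \<infinity>\<close> because \<open>C < 1\<close>.
\<close>
lemma balance_subluminal:
  assumes g: "g < 0" and e: "e > - 1" and C: "0 \<le> C" "C < 1" and T: "T > 0"
    and ub: "\<And>z. u z \<le> - e"
  shows "\<exists>l s b. Re l > 0 \<and> b = of_real e + 2 * of_real g * l\<^sup>2 \<and> s\<^sup>2 = b\<^sup>2 - 1 \<and>
    (\<forall>z. complex_of_real (u z) + b \<noteq> 0) \<and>
    Re (l * (of_real (C * T) + s * integral {0..T} (\<lambda>z. 1 / (complex_of_real (u z) + b)))) = 0"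
proof -
  define J where "J = (\<lambda>b. integral {0..T} (\<lambda>z. 1 / (u z + b)))"
  define \<Phi> where "\<Phi> = (\<lambda>b. C * T + sqrt (b\<^sup>2 - 1) * J b)"
  \<comment> \<open>Since \<open>u \<le> - e < 1\<close>, the denominator stays negative even at the
    edge \<open>b = -1\<close>, so the interval can include it.\<close>
  have neg: "u z + b < 0" if "b \<le> - 1" for z b using ub[of z] e that by simp
  have int: "(\<lambda>z. 1 / (u z + b)) integrable_on {0..T}" if "b \<le> - 1" for b
    using neg[OF that] by (intro integrable_continuous_real continuous_intros continuous_on_u) (auto simp: less_imp_neq)
  have cont: "continuous_on {..- 1} \<Phi>"
  proof -
    have "continuous_on {..- 1} (\<lambda>b. integral (cbox 0 T) (\<lambda>z. 1 / (u z + b)))"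
    proof (rule integral_continuous_on_param)
      show "continuous_on ({..- 1} \<times> cbox 0 T) (\<lambda>(b, z). 1 / (u z + b))"
        unfolding split_beta
        by (intro continuous_intros continuous_on_compose2[OF continuous_on_u[of UNIV]])
          (use neg in \<open>auto simp: less_imp_neq\<close>)
    qed
    then have "continuous_on {..- 1} J" unfolding J_def by simp
    then show ?thesis unfolding \<Phi>_def by (intro continuous_intros)
  qed
  \<comment> \<open>At \<open>b = - t\<close> the integrand is at most \<open>- 1 / (1 + t)\<close>,
    so this ratio exceeding \<open>C\<close> makes \<open>\<Phi> (- t)\<close> nonpositive.\<close>
  have "((\<lambda>t. sqrt (t\<^sup>2 - 1) / (1 + t)) \<longlongrightarrow> 1) at_top" by real_asymp
  then have "\<forall>\<^sub>F t in at_top. C < sqrt (t\<^sup>2 - 1) / (1 + t)" using C(2) by (rule order_tendstoD)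
  then have "\<forall>\<^sub>F t in at_top. t > 1 \<and> C < sqrt (t\<^sup>2 - 1) / (1 + t)"
    using eventually_gt_at_top[of 1] by eventually_elim simp
  then obtain t where t: "t > 1" "C < sqrt (t\<^sup>2 - 1) / (1 + t)"
    using eventually_happens'[OF trivial_limit_at_top_linorder] by blast
  have "\<Phi> (- t) \<le> 0"
  proof -
    have "J (- t) \<le> integral {0..T} (\<lambda>z. - (1 / (1 + t)))"
      unfolding J_def
    proof (rule integral_le)
      fix z
      have "- (u z + - t) \<le> 1 + t" using u_bound[of z] by (simp add: abs_le_iff)
      moreover have "- (u z + - t) > 0" using neg[of "- t" z] t by simp
      ultimately have "1 / (1 + t) \<le> 1 / (- (u z + - t))" by (intro divide_left_mono) auto
      then show "1 / (u z + - t) \<le> - (1 / (1 + t))" by (simp only: divide_minus_right) 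
    qed (use int[of "- t"] t in auto)
    also have "\<dots> = - (T / (1 + t))" using T by simp
    finally have "sqrt (t\<^sup>2 - 1) * J (- t) \<le> sqrt (t\<^sup>2 - 1) * - (T / (1 + t))"
      using t by (intro mult_left_mono) auto
    also have "\<dots> = - (sqrt (t\<^sup>2 - 1) / (1 + t)) * T" by simp
    also have "\<dots> \<le> - C * T" using t T by (intro mult_right_mono) auto
    finally show ?thesis unfolding \<Phi>_def by simp
  qed
  moreover have "\<Phi> (- 1) \<ge> 0" unfolding \<Phi>_def using C T by simp
  ultimately obtain \<beta> where \<beta>: "\<beta> \<le> - 1" "\<Phi> \<beta> = 0"
    using IVT'[of \<Phi> "- t" 0 "- 1"] t continuous_on_subset[OF cont, of "{- t..- 1}"] by auto
  \<comment> \<open>The real solution of \<open>e + 2 * g * x^2 = \<beta>\<close>; it exists because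
    \<open>\<beta> - e\<close> and \<open>g\<close> are both negative.\<close>
  define x where "x = sqrt ((\<beta> - e) / (2 * g))"
  have frac: "(\<beta> - e) / (2 * g) > 0" using \<beta>(1) e g by (intro divide_neg_neg) auto
  have x: "x > 0" "2 * g * x\<^sup>2 = \<beta> - e" unfolding x_def using frac g by auto
  have \<beta>2: "\<beta>\<^sup>2 - 1 \<ge> 0" using \<beta>(1) one_le_power[of "- \<beta>" 2] by simp
  have I: "integral {0..T} (\<lambda>z. 1 / (complex_of_real (u z) + of_real \<beta>)) = of_real (J \<beta>)"
    using has_integral_of_real[OF integrable_integral[OF int[OF \<beta>(1)]], where 'b = complex]
    unfolding J_def by (simp add: integral_unique)
  show ?thesis
  proof (rule exI[of _ "of_real x"], rule exI[of _ "of_real (sqrt (\<beta>\<^sup>2 - 1))"], rule exI[of _ "of_real \<beta>"], intro conjI allI)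
    show "complex_of_real \<beta> = of_real e + 2 * of_real g * (of_real x)\<^sup>2"
      using arg_cong[OF x(2), of complex_of_real] by (simp add: algebra_simps)
    show "(complex_of_real (sqrt (\<beta>\<^sup>2 - 1)))\<^sup>2 = (of_real \<beta>)\<^sup>2 - 1"
      using \<beta>2 by (simp flip: of_real_power)
    show "complex_of_real (u z) + of_real \<beta> \<noteq> 0" for z
      using neg[OF \<beta>(1), of z] by (simp flip: of_real_add)
    show "Re (of_real x * (of_real (C * T) + of_real (sqrt (\<beta>\<^sup>2 - 1)) *
        integral {0..T} (\<lambda>z. 1 / (complex_of_real (u z) + of_real \<beta>)))) = 0"
      unfolding I using \<beta>(2) unfolding \<Phi>_def by simp
  qed (use x in auto)
qed

text \<open>The balance lemmas treat \<open>|c|\<close>, once for \<open>g > 0\<close> and once for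
  subluminal orbits confined to \<open>u \<le> - e\<close>; the explicit solution then gives the
  spectral point.\<close>

lemma unstable_solution:
  assumes gc: "g * (c\<^sup>2 - 1) = 1" and e: "e > - 1"
    and cases: "g > 0 \<or> (\<forall>z. u z \<le> - e)"
  shows "\<exists>l. Re l > 0 \<and> (\<exists>(p::real \<Rightarrow> complex) p' p''.
     (\<forall>z. (p has_vector_derivative p' z) (at z)) \<and> (\<forall>z. (p' has_vector_derivative p'' z) (at z)) \<and>
     (\<forall>z. p'' z - 2 * of_real c * of_real g * l * p' z + of_real g * (l\<^sup>2 + of_real (u z)) * p z = 0) \<and>
     bounded (range p) \<and> (\<exists>z. p z \<noteq> 0))"
proof -
  obtain T where T: "T > 0" and per: "\<And>z. u (z + T) = u z" using periodic by blast
  let ?I = "\<lambda>b. integral {0..T} (\<lambda>z. 1 / (complex_of_real (u z) + b))"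
  have "\<exists>l s b. Re l > 0 \<and> b = of_real e + 2 * of_real g * l\<^sup>2 \<and> s\<^sup>2 = b\<^sup>2 - 1 \<and>
    (\<forall>z. complex_of_real (u z) + b \<noteq> 0) \<and> Re (l * (of_real (\<bar>c\<bar> * T) + s * ?I b)) = 0"
  proof (cases "g > 0")
    case True
    then have "c\<^sup>2 > 1" using gc zero_less_mult_pos[of g "c\<^sup>2 - 1"] by simp
    then have "\<bar>c\<bar> > 1" using abs_square_le_1[of c] by linarith
    then show ?thesis using balance_superluminal[OF True e _ T per] by blast
  next
    case False
    then have g: "g < 0" using g_nz by simp
    have "c\<^sup>2 < 1"
    proof (rule ccontr)
      assume "\<not> c\<^sup>2 < 1"
      then have "g * (c\<^sup>2 - 1) \<le> 0" using g by (intro mult_nonpos_nonneg) auto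
      then show False using gc by simp
    qed
    then have "\<bar>c\<bar> < 1" by (simp add: abs_square_less_1)
    then show ?thesis using balance_subluminal[OF g e _ _ T, of "\<bar>c\<bar>"] cases False by auto
  qed
  then obtain l s b where l: "Re l > 0" and b: "b = of_real e + 2 * of_real g * l\<^sup>2" and s: "s\<^sup>2 = b\<^sup>2 - 1"
    and nz: "\<And>z. complex_of_real (u z) + b \<noteq> 0" and bal: "Re (l * (of_real (\<bar>c\<bar> * T) + s * ?I b)) = 0"
    by blast
  \<comment> \<open>Only \<open>s^2\<close> is prescribed, so flipping \<open>s\<close> together
    with the sign of \<open>c\<close> merely changes the sign of the balance.\<close>
  define s' where "s' = of_real (if c \<ge> 0 then 1 else - 1) * s"
  have s': "s'\<^sup>2 = b\<^sup>2 - 1" using s unfolding s'_def by (simp add: power_mult_distrib)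
  have "l * (of_real (c * T) + s' * ?I b)
      = of_real (if c \<ge> 0 then 1 else - 1) * (l * (of_real (\<bar>c\<bar> * T) + s * ?I b))"
    unfolding s'_def by (simp add: algebra_simps)
  moreover have "Re (of_real k * w) = k * Re w" for k w by simp
  ultimately have "Re (l * (of_real (c * T) + s' * ?I b)) = 0" by (metis bal mult_zero_right)
  then show ?thesis using l floquet_solution[OF b s' nz gc T per] by blast
qed

end

section \<open>Application to sine-Gordon waves\<close>

text \<open>The energy identity reads \<open>f'^2 = 2 * g * (E - 1 + cos f)\<close>; multiplying it
  by \<open>sin^2 f = 1 - cos^2 f\<close> gives the first integral.\<close>

lemma sg_elliptic_orbit:
  assumes tw: "sg_traveling_wave c f" and en: "\<forall>z. sg_energy c f z = E" and E: "E \<noteq> 0" "E \<noteq> 2"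
  shows "elliptic_orbit (\<lambda>z. cos (f z)) (\<lambda>z. - sin (f z) * deriv f z) (sg_gamma c) (E - 1)"
proof
  define g where "g = sg_gamma c"
  have gc: "g * (c\<^sup>2 - 1) = 1" using tw by (simp add: g_def sg_gamma_def sg_traveling_wave_def)
  have f: "(f has_real_derivative deriv f z) (at z)" 
    and f': "(deriv f has_real_derivative deriv (deriv f) z) (at z)" 
    and eq: "(c\<^sup>2 - 1) * deriv (deriv f) z + sin (f z) = 0" for z
    using tw unfolding sg_traveling_wave_def by auto
  have f'': "deriv (deriv f) z = - g * sin (f z)" for z using eq[of z] gc by algebra
  have "(c\<^sup>2 - 1) * (deriv f z)\<^sup>2 = 2 * (E - 1 + cos (f z))" for z :: real
    using en[rule_format, of z] unfolding sg_energy_def by simp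
  note E' = this
  have sq: "(deriv f z)\<^sup>2 = 2 * g * (E - 1 + cos (f z))" for z using E'[of z] gc by algebra
  fix z
  show "((\<lambda>z. cos (f z)) has_real_derivative - sin (f z) * deriv f z) (at z)"
    by (auto intro!: derivative_eq_intros f)
  have "((\<lambda>z. - sin (f z) * deriv f z) has_real_derivative
      - (cos (f z) * deriv f z) * deriv f z + - sin (f z) * deriv (deriv f) z) (at z)"
    by (auto intro!: derivative_eq_intros f f')
  also have "- (cos (f z) * deriv f z) * deriv f z + - sin (f z) * deriv (deriv f) z
     = g * (1 - 2 * (E - 1) * cos (f z) - 3 * (cos (f z))\<^sup>2)"
    using sq[of z] f''[of z] sin_cos_squared_add[of "f z"] by algebra
  finally show "((\<lambda>z. - sin (f z) * deriv f z) has_real_derivative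
      sg_gamma c * (1 - 2 * (E - 1) * cos (f z) - 3 * (cos (f z))\<^sup>2)) (at z)" unfolding g_def .
  show "(- sin (f z) * deriv f z)\<^sup>2 = 2 * sg_gamma c * (1 - (cos (f z))\<^sup>2) * (E - 1 + cos (f z))"
    using sq[of z] sin_cos_squared_add[of "f z"] unfolding g_def by algebra
  show "\<bar>cos (f z)\<bar> \<le> 1" by simp
qed (use assms in \<open>auto simp: sg_gamma_def sg_traveling_wave_def\<close>)

theorem theorem1p10:
  fixes c E :: real and f :: "real \<Rightarrow> real"
  assumes "sg_traveling_wave c f"
    and "\<forall>z. sg_energy c f z = E"
  shows "(c\<^sup>2 < 1 \<and> E < 0 \<longrightarrow> sg_stable c f)
       \<and> (c\<^sup>2 > 1 \<and> E > 2 \<longrightarrow> sg_unstable c f)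
       \<and> (0 < E \<and> E < 2 \<longrightarrow> sg_unstable c f)"
proof -
  \<comment> \<open>Covers superluminal rotation and both kinds of libration at once.\<close>
  have "sg_unstable c f" if E: "E > 0" "E \<noteq> 2" and cE: "c\<^sup>2 > 1 \<or> E < 2"
  proof -
    interpret elliptic_orbit "\<lambda>z. cos (f z)" "\<lambda>z. - sin (f z) * deriv f z" "sg_gamma c" "E - 1"
      using assms E by (intro sg_elliptic_orbit) auto
    have c1: "c\<^sup>2 \<noteq> 1" using assms(1) by (simp add: sg_traveling_wave_def)
    have gc: "sg_gamma c * (c\<^sup>2 - 1) = 1" using c1 by (simp add: sg_gamma_def)
    \<comment> \<open>For a subluminal wave the kinetic term of the energy is nonpositive, which
      confines \<open>cos f\<close> below \<open>1 - E\<close>.\<close>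
    have "sg_gamma c > 0 \<or> (\<forall>z. cos (f z) \<le> - (E - 1))"
    proof (cases "c\<^sup>2 > 1")
      case True then show ?thesis by (simp add: sg_gamma_def)
    next
      case False
      have "cos (f z) \<le> - (E - 1)" for z
      proof -
        have "(c\<^sup>2 - 1) * (deriv f z)\<^sup>2 \<le> 0" using False by (intro mult_nonpos_nonneg) auto
        then show ?thesis using assms(2)[rule_format, of z] unfolding sg_energy_def mult.assoc by linarith
      qed
      then show ?thesis by blast
    qed
    then have "\<exists>l. Re l > 0 \<and> l \<in> sg_spectrum c f"
      unfolding sg_spectrum_def mem_Collect_eq using E by (intro unstable_solution[OF gc]) auto
    then show ?thesis unfolding sg_unstable_def sg_stable_def by force
  qed
  then show ?thesis using subluminal_rotational_stable[OF assms] by auto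
qed

end
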